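(* Let $R$ be a complete valuation ring which is not a field, $F$ its residue field, $Q:R\to F$ the quotient map, and $K$ the field of fractions of $R$ equipped with the induced absolute value $|\cdot|$. Suppose that $K$ is algebraically closed. Fix a cross section $\tilde F\subseteq R$ of $Q:R\to F$ (a set containing exactly one element from each fibre of $Q$) that contains $0_R$. Identify $\mathbb{A}_F^1$ with its image $Q^{\mathbb{A}}(\mathbb{A}_F^1)\subseteq \mathbb{A}_R^1$. Then: (a) $\mathbb{A}_F^1$ is closed in $\mathbb{A}_R^1$. (b) The map $\Lambda:\mathbb{A}_K^1\times[1,\infty)\to\bigcup_{\omega\in[1,\infty)}J_\omega^{\mathbb{A}}(\mathbb{A}_{K^\omega}^1)$, $\Lambda(\lambda,\omega)=J_\omega^{\mathbb{A}}(\lambda^\omega)$, is a homeomorphism (the target carrying the subspace topology from $\mathbb{A}_R^1$). (c) Let $\{(\lambda_i,\omega_i)\}_{i\in I}$ be a net in $\mathbb{A}_K^1\times[1,\infty)$. Then the net $\{\lambda_i^{\omega_i}\}_{i\in I}$ (regarded in $\mathbb{A}_R^1$ via $J_{\omega_i}^{\mathbb{A}}$) converges to an element $\lambda_0\in\mathbb{A}_F^1$ if and only if $\omega_i\to\infty$ and one of the following holds: (C1) there exist $\tau_1\in[0,1)$ and $b\in R$ such that $|\mathbf{t}-b|_{\lambda_i}^{\omega_i}\to\tau_1$ (in this case, $\lambda_0=\zeta_{Q(b),\tau_1}$); (C2) there exists $\tau_2\in(1,\infty)$ such that $|\mathbf{t}|_{\lambda_i}^{\omega_i}\to\tau_2$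 (in this case, $\lambda_0=\zeta_{0_F,\tau_2}$); (C3) $|\mathbf{t}-c|_{\lambda_i}^{\omega_i}\to 1$ for every $c\in\tilde F$ (in this case, $\lambda_0=\zeta_{0_F,1}$). (d) Under the homeomorphism in (b), $\mathbb{A}_K^1\times[1,\infty)$ may be regarded as an open dense subset of $\mathbb{A}_R^1$. Consequently, the image of $K\times(1,\infty)$ in $\mathbb{A}_R^1$ under $(r,\omega)\mapsto J_\omega^{\mathbb{A}}(\zeta_{r,0}^\omega)$ is dense in $\mathbb{A}_R^1$.
   Context: For a commutative unital Banach ring $(S,\|\cdot\|)$, $\mathbb{A}_S^1$ is the set of all non-zero multiplicative seminorms $\lambda$, written $\mathbf{p}\mapsto|\mathbf{p}|_\lambda$, on the polynomial ring $S[\mathbf{t}]$ whose restrictions to $S$ are contractive ($|a|_\lambda\le\|a\|$ for $a\in S$), with the topology of pointwise convergence. A valuation ring is an integral domain $R$ with field of fractions $K$ such that for every non-zero $x\in K$, $x\in R$ or $x^{-1}\in R$. It is a complete valuation ring if the totally ordered group $K^\times/R^\times$ is isomorphic to an ordered subgroup of $\mathbb{R}$ and $R$ is complete under the induced norm; equivalently, $R=\{a\in K:|a|\le1\}$ for a complete non-Archimedean valued field $(K,|\cdot|)$. $R$ carries the norm $|\cdot|$; $|\cdot|$ on $K$ is non-trivial exactly when $R$ is not a field. The residue field $F$ is equipped with the trivial norm. $\tilde Q:R[\mathbf{t}]\to F[\mathbf{t}]$ is the map induced by $Q$, and $Q^{\mathbb{A}}:\mathbb{A}_F^1\to\mathbb{A}_R^1$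 is the injection $\mu\mapsto\mu\circ\tilde Q$. For $\omega\in[1,\infty)$, $K^\omega$ is the field $K$ equipped with the norm $|\cdot|^\omega$, and $J_\omega^{\mathbb{A}}:\mathbb{A}_{K^\omega}^1\to\mathbb{A}_R^1$ is the injection given by restriction of seminorms to $R[\mathbf{t}]$. For $\lambda\in\mathbb{A}_K^1$, $\lambda^\omega\in\mathbb{A}_{K^\omega}^1$ is defined by $|\mathbf{p}|_{\lambda^\omega}:=|\mathbf{p}|_\lambda^\omega$. For $L=K$ (with $|\cdot|$) or $L=F$ (with the trivial norm), $s\in L$ and $\tau\in[0,\infty)$, $\zeta_{s,\tau}\in\mathbb{A}_L^1$ is given by $\left|\sum_{k=0}^n a_k(\mathbf{t}-s)^k\right|_{\zeta_{s,\tau}}=\max_k|a_k|\tau^k$, with $0^0:=1$. *)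

theory Defs
  imports "HOL-Analysis.Analysis" "HOL-Computational_Algebra.Computational_Algebra"
begin

section \<open>The analytic affine line over a normed ring\<close>

text \<open>
  The condition \<open>l 0 = 0\<close> is part of being a seminorm; without it the constant function 1 would
  qualify, since it is subadditive and multiplicative.
\<close>

definition affine_line :: "('s::comm_ring_1 \<Rightarrow> real) \<Rightarrow> ('s poly \<Rightarrow> real) set" where
  "affine_line N = {l.
     (\<forall>p. 0 \<le> l p) \<and> l 0 = 0 \<and> (\<forall>p. l (- p) = l p) \<and> (\<forall>p q. l (p + q) \<le> l p + l q) \<and>
     (\<forall>p q. l (p * q) = l p * l q) \<and>
     (\<exists>p. l p \<noteq> 0) \<and>
     (\<forall>a. l [:a:] \<le> N a)}"

definition affine_line_topology :: "('s::comm_ring_1 \<Rightarrow> real) \<Rightarrow> ('s poly \<Rightarrow> real) topology" where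
  "affine_line_topology N = subtopology (powertop_real UNIV) (affine_line N)"

definition dense_subset :: "'a topology \<Rightarrow> 'a set \<Rightarrow> bool" where
  "dense_subset X S \<longleftrightarrow> S \<subseteq> topspace X \<and> X closure_of S = topspace X"

text \<open>
  \<open>p \<circ>\<^sub>p [:s, 1:]\<close> is \<open>p(t + s)\<close>, so its coefficients are the \<open>a\<^sub>k\<close> in the expansion
  \<open>p = (\<Sum>k. a\<^sub>k (t - s)^k)\<close>.
\<close>

definition zeta :: "('l::field \<Rightarrow> real) \<Rightarrow> 'l \<Rightarrow> real \<Rightarrow> 'l poly \<Rightarrow> real" where
  "zeta N s \<tau> p = Max ((\<lambda>k. N (coeff (p \<circ>\<^sub>p [:s, 1:]) k) * \<tau> ^ k) ` {..degree p})"

definition trivial_norm :: "'f::field \<Rightarrow> real" where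
  "trivial_norm a = (if a = 0 then 0 else 1)"

definition norm_power :: "('a \<Rightarrow> real) \<Rightarrow> real \<Rightarrow> 'a \<Rightarrow> real" where
  "norm_power l \<omega> = (\<lambda>x. l x powr \<omega>)"

section \<open>Complete valuation rings\<close>

text \<open>The ring \<open>R\<close> is the type \<open>'r\<close>, its field of fractions \<open>K\<close> is \<open>'r fract\<close>.\<close>

definition valuation_ring :: "'r::idom itself \<Rightarrow> bool" where
  "valuation_ring _ \<longleftrightarrow>
     (\<forall>x::'r fract. x \<noteq> 0 \<longrightarrow> x \<in> range to_fract \<or> inverse x \<in> range to_fract)"

text \<open>
  The classes of \<open>x\<close> and \<open>y\<close> in the totally ordered group \<open>K\<^sup>\<times>/R\<^sup>\<times>\<close> are compared by
  \<open>x / y \<in> R\<close>. Hence \<open>nu\<close> is an induced absolute value iff \<open>x \<mapsto> ln (nu x)\<close> is a well-defined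
  isomorphism of \<open>K\<^sup>\<times>/R\<^sup>\<times>\<close> onto an ordered subgroup of the reals (and \<open>nu 0 = 0\<close>). It is only
  determined up to the choice of this isomorphism.
\<close>

definition induced_absolute_value :: "('r::idom fract \<Rightarrow> real) \<Rightarrow> bool" where
  "induced_absolute_value nu \<longleftrightarrow>
     nu 0 = 0 \<and> (\<forall>x. x \<noteq> 0 \<longrightarrow> 0 < nu x) \<and>
     (\<forall>x y. nu (x * y) = nu x * nu y) \<and>
     (\<forall>x y. x \<noteq> 0 \<longrightarrow> y \<noteq> 0 \<longrightarrow> (nu x \<le> nu y \<longleftrightarrow> x / y \<in> range to_fract))"

definition ring_norm :: "('r::idom fract \<Rightarrow> real) \<Rightarrow> 'r \<Rightarrow> real" where
  "ring_norm nu a = nu (to_fract a)"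

definition complete_valuation_ring :: "('r::idom fract \<Rightarrow> real) \<Rightarrow> bool" where
  "complete_valuation_ring nu \<longleftrightarrow>
     valuation_ring TYPE('r) \<and> induced_absolute_value nu \<and>
     Metric_space.mcomplete UNIV (\<lambda>a b. ring_norm nu (a - b))"

lemma induced_absolute_value_one:
  assumes "induced_absolute_value nu"
  shows "nu 1 = 1"
proof -
  have "nu 1 * nu 1 = nu 1" "nu 1 > 0"
    using assms unfolding induced_absolute_value_def by (metis mult_1, simp)
  then show ?thesis by simp
qed

lemma induced_absolute_value_unit_ball:
  assumes "induced_absolute_value nu"
  shows "range to_fract = {x. nu x \<le> 1}"
proof -
  have "x \<in> range to_fract \<longleftrightarrow> nu x \<le> 1" for x
  proof (cases "x = 0")
    case True
    then have "x = to_fract 0" by simp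
    with True assms show ?thesis unfolding induced_absolute_value_def by auto
  next
    case False
    with assms have "nu x \<le> nu 1 \<longleftrightarrow> x / 1 \<in> range to_fract"
      unfolding induced_absolute_value_def by (metis zero_neq_one)
    then show ?thesis using induced_absolute_value_one[OF assms] by simp
  qed
  then show ?thesis by blast
qed

lemma induced_absolute_value_ultrametric:
  assumes "induced_absolute_value nu"
  shows "nu (x + y) \<le> max (nu x) (nu y)"
proof -
  have *: "nu (x + y) \<le> nu y" if le: "nu x \<le> nu y" for x y
  proof (cases "x = 0 \<or> y = 0")
    case True
    then show ?thesis using that assms unfolding induced_absolute_value_def
      by (metis add_0 add.right_neutral leD linorder_linear order_refl)
  next
    case False
    then obtain r where "x / y = to_fract r"
      using le assms unfolding induced_absolute_value_def by (metis imageE)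
    then have "(x + y) / y = to_fract (r + 1)" using False
      by (simp add: add_divide_distrib)
    then have "nu ((x + y) / y) \<le> 1" using induced_absolute_value_unit_ball[OF assms] by blast
    moreover have "nu (x + y) = nu ((x + y) / y) * nu y"
      using assms False unfolding induced_absolute_value_def
      by (metis nonzero_eq_divide_eq)
    moreover have "0 < nu y" using assms False unfolding induced_absolute_value_def by auto
    ultimately show ?thesis
      by simp
  qed
  show ?thesis
    using *[of x y] *[of y x] by (cases "nu x \<le> nu y") (auto simp: add.commute max_def)
qed

text \<open>
  A quotient map onto the residue field: the maximal ideal of a valuation ring is the set of its
  non-units.
\<close>

definition residue_map :: "('r::idom \<Rightarrow> 'f::field) \<Rightarrow> bool" where
  "residue_map Q \<longleftrightarrow>
     (\<forall>a b. Q (a + b) = Q a + Q b) \<and> (\<forall>a b. Q (a * b) = Q a * Q b) \<and> Q 1 = 1 \<and>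
     surj Q \<and> (\<forall>a. Q a = 0 \<longleftrightarrow> \<not> a dvd 1)"

text \<open>A condition on the single type \<open>'r fract\<close>, which is not an instance of the class
  \<open>alg_closed_field\<close> in general.\<close>

definition algebraically_closed_field :: "'k::field itself \<Rightarrow> bool" where
  "algebraically_closed_field _ \<longleftrightarrow> (\<forall>p::'k poly. degree p > 0 \<longrightarrow> (\<exists>x. poly p x = 0))"

definition cross_section :: "('r \<Rightarrow> 'f) \<Rightarrow> 'r set \<Rightarrow> bool" where
  "cross_section Q C \<longleftrightarrow> (\<forall>y. \<exists>!c. c \<in> C \<and> Q c = y)"

section \<open>Maps between affine lines\<close>

definition Q_affine :: "('r::idom \<Rightarrow> 'f::field) \<Rightarrow> ('f poly \<Rightarrow> real) \<Rightarrow> 'r poly \<Rightarrow> real" where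
  "Q_affine Q \<mu> = \<mu> \<circ> map_poly Q"

text \<open>
  Only the domain of \<open>J\<^sub>\<omega>\<close> depends on \<open>\<omega>\<close>: it is \<open>affine_line (norm_power nu \<omega>)\<close>.
\<close>

definition J_affine :: "('r::idom fract poly \<Rightarrow> real) \<Rightarrow> 'r poly \<Rightarrow> real" where
  "J_affine l = l \<circ> map_poly to_fract"

definition Lambda :: "('r::idom fract poly \<Rightarrow> real) \<times> real \<Rightarrow> 'r poly \<Rightarrow> real" where
  "Lambda = (\<lambda>(l, \<omega>). J_affine (norm_power l \<omega>))"

section \<open>Nets\<close>

definition directed_index :: "'i set \<Rightarrow> ('i \<Rightarrow> 'i \<Rightarrow> bool) \<Rightarrow> bool" where
  "directed_index I le \<longleftrightarrow>
     I \<noteq> {} \<and> (\<forall>i\<in>I. le i i) \<and>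
     (\<forall>i\<in>I. \<forall>j\<in>I. \<forall>k\<in>I. le i j \<longrightarrow> le j k \<longrightarrow> le i k) \<and>
     (\<forall>i\<in>I. \<forall>j\<in>I. \<exists>k\<in>I. le i k \<and> le j k)"

text \<open>Convergence of a net is convergence along the filter generated by its tails.\<close>

definition net_filter :: "'i set \<Rightarrow> ('i \<Rightarrow> 'i \<Rightarrow> bool) \<Rightarrow> 'i filter" where
  "net_filter I le = (INF i\<in>I. principal {j \<in> I. le i j})"

lemma eventually_net_filter:
  assumes "directed_index I le"
  shows "eventually P (net_filter I le) \<longleftrightarrow> (\<exists>i\<in>I. \<forall>j\<in>I. le i j \<longrightarrow> P j)"
proof -
  have "eventually P (net_filter I le) \<longleftrightarrow> (\<exists>i\<in>I. eventually P (principal {j \<in> I. le i j}))"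
    unfolding net_filter_def
  proof (rule eventually_INF_base)
    show "I \<noteq> {}" using assms by (simp add: directed_index_def)
  next
    fix a b assume ab: "a \<in> I" "b \<in> I"
    then obtain k where "k \<in> I" "le a k" "le b k"
      using assms unfolding directed_index_def by meson
    moreover have "{j \<in> I. le k j} \<subseteq> {j \<in> I. le a j} \<inter> {j \<in> I. le b j}"
      using assms ab calculation unfolding directed_index_def by blast
    ultimately show "\<exists>x\<in>I. principal {j \<in> I. le x j}
        \<le> inf (principal {j \<in> I. le a j}) (principal {j \<in> I. le b j})"
      by (auto intro!: bexI[of _ k])
  qed
  then show ?thesis by (auto simp: eventually_principal)
qed

end

theory Submission
  imports Defs
begin

text \<open>
  Every point of the affine line over \<open>R\<close> is an ultrametric seminorm, because the norm is at most 1
  on the integers. Fix a non-zero non-unit \<open>\<pi>\<close> of \<open>R\<close>; since the valuation has rank one, some power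
  of any other non-unit is divisible by \<open>\<pi>\<close>, and any non-zero element divides some power of \<open>\<pi>\<close>.
  So a point \<open>l\<close> either vanishes on the whole maximal ideal or is non-zero on \<open>R - {0}\<close>, according
  to whether \<open>l \<pi>\<close> is zero or not.

  If \<open>l \<pi> = 0\<close>, then \<open>l\<close> factors through \<open>F[t]\<close> (lemma \<open>Q_affine_image\<close>); this condition is closed.
  If \<open>l \<pi> > 0\<close>, then \<open>l\<close> compares elements of \<open>R\<close> in the same way as \<open>nu\<close>, hence agrees on \<open>R\<close> with
  \<open>nu\<close> raised to the power \<open>\<omega> = ln (l \<pi>) / ln (nu \<pi>) \<ge> 1\<close> (lemma \<open>generic_part_const\<close>). Clearing
  denominators extends \<open>l\<close> to \<open>K[t]\<close>, and the extension to the power \<open>1 / \<omega>\<close> is a point over \<open>K\<close>.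
  These formulas for the inverse of \<open>Lambda\<close> are continuous in \<open>l\<close>, so \<open>Lambda\<close> is a homeomorphism
  onto the open set where \<open>l \<pi> > 0\<close>.

  For a net \<open>lam i\<close> with exponents \<open>\<omega> i\<close>, convergence into the closed part forces
  \<open>nu \<pi> powr \<omega> i\<close> to tend to 0, that is, \<open>\<omega> i\<close> to tend to infinity. Conversely, once \<open>\<omega> i\<close> tends to
  infinity, every non-unit tends to 0, so that a polynomial over \<open>R\<close> matters only modulo the maximal
  ideal. The residue field is algebraically closed together with \<open>K\<close>; hence modulo the maximal ideal
  each polynomial is a product of a constant and of linear factors \<open>t - c\<close>, and
  convergence at the factors \<open>t - c\<close> suffices (lemma \<open>converges_if_linear_converge\<close>). Over a
  trivially valued algebraically closed field the values at linear polynomials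
  leave only three shapes for the limit, which are the three alternatives of the convergence criterion.

  For density, a point over \<open>K\<close> is also determined by its values at the polynomials \<open>t - a\<close>. Finitely
  many of these can be approximated at once by \<open>nu (r - a)\<close> for a single \<open>r\<close>, because the absolute
  values of elements of \<open>K\<close> are dense in the positive reals (lemma \<open>classical_approximation\<close>). The
  points over \<open>F\<close> are limits of classical points by the convergence criterion
  (lemma \<open>residue_part_in_closure\<close>).
\<close>

section \<open>Ultrametric multiplicative seminorms\<close>

locale ultrametric_seminorm =
  fixes l :: "'a::comm_ring_1 \<Rightarrow> real"
  assumes nonneg: "0 \<le> l p"
    and zero: "l 0 = 0"
    and one: "l 1 = 1"
    and mult: "l (p * q) = l p * l q"
    and ultra: "l (p + q) \<le> max (l p) (l q)"
begin

lemma power: "l (p ^ n) = l p ^ n"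
  by (induction n) (simp_all add: one mult)

lemma minus: "l (- p) = l p"
proof -
  have "l (- 1) * l (- 1) = l 1"
    by (metis mult mult_minus_left mult_minus_right mult_1 minus_minus)
  then have "l (- 1) = 1"
    using nonneg[of "- 1"] one square_eq_1_iff[of "l (- 1)"] by auto
  then show ?thesis using mult[of "- 1" p] by simp
qed

lemma minus_commute: "l (p - q) = l (q - p)"
  using minus[of "p - q"] by simp

lemma subadditive: "l (p + q) \<le> l p + l q"
  using ultra[of p q] nonneg[of p] nonneg[of q] by linarith

lemma ultra_diff: "l (p - q) \<le> max (l p) (l q)"
  using ultra[of p "- q"] by (simp add: minus)

lemma abs_diff_le: "\<bar>l p - l q\<bar> \<le> l (p - q)"
  using subadditive[of "p - q" q] subadditive[of "q - p" p] minus_commute[of p q] by simp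

lemma dominant: "l q < l p \<Longrightarrow> l (p + q) = l p"
  using ultra[of p q] ultra_diff[of "p + q" q] by (auto simp: max_def split: if_splits)

lemma dominant_diff: "l q < l p \<Longrightarrow> l (p - q) = l p"
  using dominant[of "- q" p] by (simp add: minus)

lemma of_nat_le_one: "l (of_nat n) \<le> 1"
proof (induction n)
  case (Suc n)
  then show ?case using ultra[of 1 "of_nat n"] by (simp add: one)
qed (simp add: zero)

lemma powr_seminorm: "0 < \<omega> \<Longrightarrow> ultrametric_seminorm (\<lambda>p. l p powr \<omega>)"
proof
  fix p q assume \<omega>: "0 < \<omega>"
  have "l (p + q) powr \<omega> \<le> max (l p) (l q) powr \<omega>"
    by (rule powr_mono2) (use \<omega> nonneg ultra in auto)
  then show "l (p + q) powr \<omega> \<le> max (l p powr \<omega>) (l q powr \<omega>)"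
    by (auto simp: max_def split: if_splits)
qed (auto simp: zero one mult powr_mult)

lemma comp_seminorm:
  assumes "f 0 = 0" "f 1 = 1" "\<And>x y. f (x + y) = f x + f y" "\<And>x y. f (x * y) = f x * f y"
  shows "ultrametric_seminorm (l \<circ> f)"
  by unfold_locales (auto simp: assms nonneg zero one mult ultra)

end

lemma ultrametric_seminorm_tendsto:
  assumes "F \<noteq> bot" and ev: "\<forall>\<^sub>F i in F. ultrametric_seminorm (l i)"
    and lim: "\<And>p. ((\<lambda>i. l i p) \<longlongrightarrow> L p) F"
  shows "ultrametric_seminorm L"
proof
  fix p q
  show "0 \<le> L p"
    by (rule tendsto_lowerbound[OF lim]) 
      (use ev assms(1) in \<open>auto elim: eventually_mono intro: ultrametric_seminorm.nonneg\<close>)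
  have "((\<lambda>i. l i 0) \<longlongrightarrow> 0) F"
    by (rule tendsto_eventually) (use ev in \<open>auto elim: eventually_mono intro: ultrametric_seminorm.zero\<close>)
  then show "L 0 = 0" using lim tendsto_unique assms(1) by blast
  have "((\<lambda>i. l i 1) \<longlongrightarrow> 1) F"
    by (rule tendsto_eventually) (use ev in \<open>auto elim: eventually_mono intro: ultrametric_seminorm.one\<close>)
  then show "L 1 = 1" using lim tendsto_unique assms(1) by blast
  have "((\<lambda>i. l i (p * q)) \<longlongrightarrow> L p * L q) F"
    by (rule Lim_transform_eventually[OF tendsto_mult[OF lim[of p] lim[of q]]])
      (use ev in \<open>auto elim: eventually_mono simp: ultrametric_seminorm.mult\<close>)
  then show "L (p * q) = L p * L q" using lim tendsto_unique assms(1) by blast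
  show "L (p + q) \<le> max (L p) (L q)"
    by (rule tendsto_le[OF assms(1) tendsto_max[OF lim[of p] lim[of q]] lim])
      (use ev in \<open>auto elim: eventually_mono intro: ultrametric_seminorm.ultra\<close>)
qed

text \<open>
  Expanding \<open>(p + q) ^ n\<close> binomially bounds \<open>l (p + q) ^ n\<close> by \<open>(n + 1) * max (l p) (l q) ^ n\<close>,
  because \<open>l\<close> is at most 1 on the binomial coefficients. If \<open>l (p + q)\<close> exceeded the maximum, the
  quotient of the two sides would grow exponentially, faster than \<open>n + 1\<close>.
\<close>

lemma ultrametric_if_of_nat_le_one:
  fixes l :: "'a::comm_ring_1 \<Rightarrow> real"
  assumes nonneg: "\<And>p. 0 \<le> l p" and zero: "l 0 = 0" and one: "l 1 = 1"
    and add: "\<And>p q. l (p + q) \<le> l p + l q"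
    and mult: "\<And>p q. l (p * q) = l p * l q"
    and nat: "\<And>n. l (of_nat n) \<le> 1"
  shows "l (p + q) \<le> max (l p) (l q)"
proof (rule ccontr)
  assume neg: "\<not> l (p + q) \<le> max (l p) (l q)"
  define M where "M = max (l p) (l q)"
  have power: "l (r ^ n) = l r ^ n" for r n by (induction n) (simp_all add: one mult)
  have sum: "l (sum f A) \<le> (\<Sum>a\<in>A. l (f a))" if "finite A" for f and A :: "nat set"
    using that
  proof induction
    case (insert x F)
    then show ?case using add[of "f x" "sum f F"] by simp
  qed (simp add: zero)
  have M: "0 < M"
    using neg add[of p q] nonneg[of p] nonneg[of q] by (auto simp: M_def max_def split: if_splits)
  define x where "x = l (p + q) / M"
  have x: "x > 1" using neg M by (simp add: x_def less_divide_eq flip: M_def)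
  have bound: "x ^ n \<le> real (Suc n)" for n
  proof -
    have summand: "l (of_nat (n choose k) * p ^ k * q ^ (n - k)) \<le> M ^ n" if "k \<le> n" for k
    proof -
      have "l p ^ k * l q ^ (n - k) \<le> M ^ k * M ^ (n - k)"
        by (intro mult_mono power_mono) (auto simp: M_def nonneg max_def intro: order_trans)
      moreover have "l (of_nat (n choose k)) * (l p ^ k * l q ^ (n - k)) \<le> 1 * (l p ^ k * l q ^ (n - k))"
        by (intro mult_right_mono nat mult_nonneg_nonneg zero_le_power nonneg)
      ultimately show ?thesis using that
        by (simp add: mult power mult.assoc flip: power_add)
    qed
    have "l (p + q) ^ n = l (\<Sum>k\<le>n. of_nat (n choose k) * p ^ k * q ^ (n - k))"
      by (simp only: binomial_ring flip: power)
    also have "\<dots> \<le> (\<Sum>k\<le>n. l (of_nat (n choose k) * p ^ k * q ^ (n - k)))" by (rule sum) simp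
    also have "\<dots> \<le> (\<Sum>k\<le>n. M ^ n)" by (rule sum_mono) (use summand in auto)
    finally show ?thesis using M by (simp add: x_def power_divide field_simps)
  qed
  have "(\<lambda>n. real n * (1 / x) ^ n) \<longlonglongrightarrow> 0"
    by (rule powser_times_n_limit_0) (use x in simp)
  moreover have "(\<lambda>n. (1 / x) ^ n) \<longlonglongrightarrow> 0"
    by (rule LIMSEQ_power_zero) (use x in simp)
  ultimately have "(\<lambda>n. real n * (1 / x) ^ n + (1 / x) ^ n) \<longlonglongrightarrow> 0 + 0"
    by (rule tendsto_add)
  then have "eventually (\<lambda>n. real n * (1 / x) ^ n + (1 / x) ^ n < 1) sequentially"
    by (rule order_tendstoD) simp
  then obtain n where "real n * (1 / x) ^ n + (1 / x) ^ n < 1"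
    by (auto simp: eventually_sequentially)
  then have "real (Suc n) < x ^ n" using x by (simp add: field_simps power_one_over)
  with bound[of n] show False by simp
qed

lemma affine_line_iff_ultrametric:
  fixes N :: "'s::comm_ring_1 \<Rightarrow> real"
  assumes N: "\<And>n. N (of_nat n) \<le> 1"
  shows "l \<in> affine_line N \<longleftrightarrow> ultrametric_seminorm l \<and> (\<forall>a. l [:a:] \<le> N a)"
proof
  assume "l \<in> affine_line N"
  then have l: "\<And>p. 0 \<le> l p" "l 0 = 0" "\<And>p q. l (p + q) \<le> l p + l q"
      "\<And>p q. l (p * q) = l p * l q" "\<exists>p. l p \<noteq> 0" "\<And>a. l [:a:] \<le> N a"
    by (auto simp: affine_line_def)
  from l(5) obtain p where "l p \<noteq> 0" by blast
  then have one: "l 1 = 1" using l(4)[of p 1] by simp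
  have nat: "l (of_nat n) \<le> 1" for n
    using l(6)[of "of_nat n"] N[of n] by (simp add: of_nat_poly)
  show "ultrametric_seminorm l \<and> (\<forall>a. l [:a:] \<le> N a)"
    using ultrametric_if_of_nat_le_one[of l, OF l(1,2) one l(3,4) nat] l one
    by (auto intro!: ultrametric_seminorm.intro)
next
  assume A: "ultrametric_seminorm l \<and> (\<forall>a. l [:a:] \<le> N a)"
  then interpret ultrametric_seminorm l by simp
  show "l \<in> affine_line N"
    using A one by (auto simp: affine_line_def nonneg zero minus subadditive mult intro!: exI[of _ 1])
qed

lemma (in ultrametric_seminorm) affine_line_iff:
  "m \<in> affine_line l \<longleftrightarrow> ultrametric_seminorm m \<and> (\<forall>a. m [:a:] \<le> l a)"
  by (rule affine_line_iff_ultrametric) (rule of_nat_le_one)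

text \<open>
  Over a field the inequality \<open>l a \<le> N a\<close> also holds for the inverse of \<open>a\<close>, which turns it into
  an equality.
\<close>

lemma affine_line_const:
  fixes N :: "'k::field \<Rightarrow> real"
  assumes N: "ultrametric_seminorm N" and l: "l \<in> affine_line N"
  shows "l [:a:] = N a"
proof (cases "a = 0")
  case False
  interpret N: ultrametric_seminorm N by fact
  interpret l: ultrametric_seminorm l using l by (simp add: N.affine_line_iff)
  have le: "l [:b:] \<le> N b" for b using l by (simp add: N.affine_line_iff)
  have eq: "l [:a:] * l [:inverse a:] = 1" "N a * N (inverse a) = 1"
    using False by (simp_all flip: l.mult N.mult one_pCons add: l.one N.one)
  then have pos: "0 < N a" using N.nonneg[of a] by (cases "N a = 0") auto
  have "N a * (l [:a:] * l [:inverse a:]) \<le> N a * (l [:a:] * N (inverse a))"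
    using pos le[of "inverse a"] l.nonneg[of "[:a:]"] by (intro mult_left_mono) auto
  also have "\<dots> = l [:a:] * (N a * N (inverse a))" by (simp add: algebra_simps)
  finally have "N a \<le> l [:a:]" using eq by simp
  with le[of a] show ?thesis by simp
next
  case True
  then show ?thesis using N l
    by (simp add: ultrametric_seminorm.zero ultrametric_seminorm.affine_line_iff[OF N])
qed

section \<open>Polynomials that split into linear factors\<close>

text \<open>
  This replaces the factorisation of \<open>p\<close> into linear factors: it proves statements that are
  compatible with products.
\<close>

lemma algebraically_closed_induct [consumes 1, case_names const linear times]:
  fixes p :: "'k::field poly"
  assumes "algebraically_closed_field TYPE('k)"
    and const: "\<And>a. P [:a:]"
    and linear: "\<And>s. P [:- s, 1:]"
    and mult: "\<And>p q. P p \<Longrightarrow> P q \<Longrightarrow> P (p * q)"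
  shows "P p"
proof (induction "degree p" arbitrary: p)
  case 0
  then show ?case using const by (metis degree_eq_zeroE)
next
  case (Suc n)
  then obtain x where "poly p x = 0"
    using assms(1) by (metis algebraically_closed_field_def zero_less_Suc)
  then obtain q where q: "p = [:- x, 1:] * q" by (metis dvdE poly_eq_0_iff_dvd)
  have "q \<noteq> 0" using Suc(2) q by auto
  then have "degree p = Suc (degree q)"
    unfolding q by (subst degree_mult_eq) auto
  then have "P q" using Suc by simp
  then show ?case unfolding q by (intro mult linear)
qed

section \<open>Identification of the points over a trivially valued field\<close>

lemma ultrametric_seminorm_trivial_norm: "ultrametric_seminorm (trivial_norm :: 'k::field \<Rightarrow> real)"
  by unfold_locales (auto simp: trivial_norm_def)

lemmas affine_line_trivial = ultrametric_seminorm.affine_line_iff[OF ultrametric_seminorm_trivial_norm]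

lemmas affine_line_trivial_const = affine_line_const[OF ultrametric_seminorm_trivial_norm]

text \<open>
  The expansion of \<open>p\<close> in powers of \<open>t - s\<close> begins with the exponent \<open>order s p\<close>.
\<close>

lemma order_pcompose_linear:
  fixes p :: "'a::field poly"
  assumes "p \<noteq> 0"
  shows "coeff (p \<circ>\<^sub>p [:s, 1:]) (order s p) \<noteq> 0"
    and "\<And>k. k < order s p \<Longrightarrow> coeff (p \<circ>\<^sub>p [:s, 1:]) k = 0"
proof -
  obtain q where q: "p = [:- s, 1:] ^ order s p * q" "poly q s \<noteq> 0"
    using order_decomp[OF assms, of s] by (auto simp: poly_eq_0_iff_dvd)
  have "[:- s, 1:] ^ n \<circ>\<^sub>p [:s, 1:] = monom 1 n" for n
    
  proof (induction n)
    case (Suc n)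
    have "[:- s, 1:] \<circ>\<^sub>p [:s, 1:] = [:0, 1:]" by (simp add: pcompose_pCons)
    then show ?case using Suc by (simp only: power_Suc pcompose_mult) (simp add: monom_Suc)
  qed (simp add: pcompose_1)
  then have eq: "p \<circ>\<^sub>p [:s, 1:] = monom 1 (order s p) * (q \<circ>\<^sub>p [:s, 1:])"
    by (metis q(1) pcompose_mult)
  show "coeff (p \<circ>\<^sub>p [:s, 1:]) (order s p) \<noteq> 0"
    using q(2) by (simp add: eq coeff_monom_mult poly_pcompose flip: poly_0_coeff_0)
  show "\<And>k. k < order s p \<Longrightarrow> coeff (p \<circ>\<^sub>p [:s, 1:]) k = 0"
    by (simp add: eq coeff_monom_mult)
qed

lemma zeta_trivial_eqI:
  assumes "k \<le> degree p" "coeff (p \<circ>\<^sub>p [:s, 1:]) k \<noteq> 0"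
    and "\<And>j. j \<le> degree p \<Longrightarrow> coeff (p \<circ>\<^sub>p [:s, 1:]) j \<noteq> 0 \<Longrightarrow> \<tau> ^ j \<le> \<tau> ^ k"
    and "0 \<le> \<tau>"
  shows "zeta trivial_norm s \<tau> p = \<tau> ^ k"
  unfolding zeta_def
proof (rule Max_eqI)
  show "\<tau> ^ k \<in> (\<lambda>k. trivial_norm (coeff (p \<circ>\<^sub>p [:s, 1:]) k) * \<tau> ^ k) ` {..degree p}"
    using assms(1,2) by (intro image_eqI[of _ _ k]) (auto simp: trivial_norm_def)
qed (use assms in \<open>auto simp: trivial_norm_def\<close>)

lemma zeta_zero: "N 0 = 0 \<Longrightarrow> zeta N s \<tau> 0 = 0"
  by (simp add: zeta_def)

lemma zeta_trivial_radius_le_one: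
  assumes "0 \<le> \<tau>" "\<tau> \<le> 1" "p \<noteq> 0"
  shows "zeta trivial_norm s \<tau> p = \<tau> ^ order s p"
  by (rule zeta_trivial_eqI)
    (use assms order_pcompose_linear[OF assms(3), where s = s] order_degree[OF assms(3)] in
      \<open>auto intro!: power_decreasing intro: leI\<close>)

lemma zeta_trivial_radius_ge_one:
  assumes "1 \<le> \<tau>" "p \<noteq> 0"
  shows "zeta trivial_norm s \<tau> p = \<tau> ^ degree p"
proof (rule zeta_trivial_eqI)
  have "degree (p \<circ>\<^sub>p [:s, 1:]) = degree p" by (simp add: degree_pcompose)
  moreover have "p \<circ>\<^sub>p [:s, 1:] \<noteq> 0" using pcompose_eq_0[of p "[:s, 1:]"] assms(2) by auto
  ultimately show "coeff (p \<circ>\<^sub>p [:s, 1:]) (degree p) \<noteq> 0" by (metis leading_coeff_0_iff)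
qed (use assms in \<open>auto intro: power_increasing\<close>)

text \<open>
  If \<open>l (t - s) < 1\<close>, then \<open>l (t - s') = 1\<close> for all \<open>s' \<noteq> s\<close>, because the constant \<open>s - s'\<close> has
  norm 1 and dominates. So \<open>l p\<close> only counts how often the factor \<open>t - s\<close> occurs in \<open>p\<close>.
\<close>

lemma affine_line_trivial_eq_zeta_radius_less_one:
  fixes l :: "'k::field poly \<Rightarrow> real"
  assumes acf: "algebraically_closed_field TYPE('k)"
    and l: "l \<in> affine_line trivial_norm" and \<tau>: "l [:- s, 1:] = \<tau>" "\<tau> < 1"
  shows "l = zeta trivial_norm s \<tau>"
proof
  fix p
  interpret ultrametric_seminorm l using l by (simp add: affine_line_trivial)
  have nonneg': "0 \<le> \<tau>" using nonneg \<tau> by blast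
  have "l p = (if p = 0 then 0 else \<tau> ^ order s p)" using acf
  proof (induction p rule: algebraically_closed_induct)
    case (const a)
    then show ?case using affine_line_trivial_const[OF l, of a]
      by (auto simp: trivial_norm_def order_0I)
  next
    case (linear s')
    show ?case
    proof (cases "s' = s")
      case True
      then show ?thesis using \<tau> order_power_n_n[of s 1] by simp
    next
      case False
      have "l [:s - s':] = 1" using False affine_line_trivial_const[OF l]
        by (simp add: trivial_norm_def)
      then have "l ([:s - s':] + [:- s, 1:]) = 1" using \<tau> by (subst dominant) auto
      then show ?thesis using False by (simp add: order_0I)
    qed
  next
    case (times p q)
    then show ?case by (auto simp: mult zero order_mult power_add)
  qed
  then show "l p = zeta trivial_norm s \<tau> p"
    using nonneg' \<tau>(2) by (simp add: zeta_trivial_radius_le_one zeta_zero trivial_norm_def)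
qed

text \<open>
  Here all linear factors contribute the same value, so \<open>l p\<close> depends only on the degree of \<open>p\<close>.
\<close>

lemma affine_line_trivial_eq_zeta_radius_ge_one:
  fixes l :: "'k::field poly \<Rightarrow> real"
  assumes acf: "algebraically_closed_field TYPE('k)"
    and l: "l \<in> affine_line trivial_norm" and \<tau>: "\<And>s. l [:- s, 1:] = \<tau>" "1 \<le> \<tau>"
  shows "l = zeta trivial_norm 0 \<tau>"
proof
  fix p
  interpret ultrametric_seminorm l using l by (simp add: affine_line_trivial)
  have "l p = (if p = 0 then 0 else \<tau> ^ degree p)" using acf
  proof (induction p rule: algebraically_closed_induct)
    case (const a)
    then show ?case using affine_line_trivial_const[OF l, of a]
      by (auto simp: trivial_norm_def)
  next
    case (linear s')
    show ?case by (simp add: \<tau>)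
  next
    case (times p q)
    then show ?case by (auto simp: mult zero degree_mult_eq power_add)
  qed
  then show "l p = zeta trivial_norm 0 \<tau> p"
    using \<tau>(2) by (simp add: zeta_trivial_radius_ge_one zeta_zero trivial_norm_def)
qed

section \<open>Fields of fractions of rank-one valuation rings\<close>

locale rank_one_valuation =
  fixes nu :: "'r::idom fract \<Rightarrow> real"
  assumes abs_value: "induced_absolute_value nu"
    and nontrivial: "\<exists>a::'r. a \<noteq> 0 \<and> \<not> a dvd 1"

sublocale rank_one_valuation \<subseteq> nu: ultrametric_seminorm nu
proof
  fix x y
  show "nu (x + y) \<le> max (nu x) (nu y)"
    by (rule induced_absolute_value_ultrametric[OF abs_value])
  show "0 \<le> nu x" "nu 0 = 0" "nu 1 = 1" "nu (x * y) = nu x * nu y"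
    using abs_value induced_absolute_value_one[OF abs_value]
    by (auto simp: induced_absolute_value_def intro: order.strict_implies_order dest!: spec[of _ x] split: if_splits)
qed

context rank_one_valuation
begin

lemma nu_pos: "x \<noteq> 0 \<Longrightarrow> 0 < nu x"
  using abs_value by (auto simp: induced_absolute_value_def)

lemma nu_eq_0_iff [simp]: "nu x = 0 \<longleftrightarrow> x = 0"
  using nu_pos[of x] nu.zero by (cases "x = 0") auto

lemma nu_le_iff_dvd: "nu (to_fract a) \<le> nu (to_fract b) \<longleftrightarrow> b dvd a"
proof (cases "a = 0 \<or> b = 0")
  case True
  then show ?thesis using nu_pos[of "to_fract a"] by (cases "a = 0") (auto simp: nu.zero nu.nonneg)
next
  case False
  then have "nu (to_fract a) \<le> nu (to_fract b) \<longleftrightarrow> to_fract a / to_fract b \<in> range to_fract"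
    using abs_value by (simp add: induced_absolute_value_def)
  also have "\<dots> \<longleftrightarrow> (\<exists>r. to_fract a = to_fract (b * r))"
    using False by (auto simp: image_iff nonzero_divide_eq_eq mult.commute)
  also have "\<dots> \<longleftrightarrow> b dvd a" by (simp add: dvd_def del: to_fract_mult)
  finally show ?thesis .
qed

lemma nu_to_fract_le_one: "nu (to_fract a) \<le> 1"
  using nu_le_iff_dvd[of a 1] by (simp add: nu.one)

lemma dvd_one_iff: "a dvd 1 \<longleftrightarrow> nu (to_fract a) = 1"
  using nu_le_iff_dvd[of 1 a] nu_to_fract_le_one[of a] by (auto simp: nu.one)

lemma not_dvd_one_iff: "\<not> a dvd 1 \<longleftrightarrow> nu (to_fract a) < 1"
  using nu_to_fract_le_one[of a] by (auto simp: dvd_one_iff)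

lemma in_range_to_fract: "nu x \<le> 1 \<Longrightarrow> \<exists>a. x = to_fract a"
  using induced_absolute_value_unit_ball[OF abs_value] by blast

lemma nu_power_int: "nu (x powi m) = nu x powi m"
proof -
  have "nu (inverse x) = inverse (nu x)"
  proof (cases "x = 0")
    case False
    then have "nu x * nu (inverse x) = 1" by (simp add: nu.one flip: nu.mult)
    then show ?thesis by (simp add: inverse_unique)
  qed (simp add: nu.zero)
  then show ?thesis by (simp add: power_int_def nu.power)
qed

definition pseudo_uniformizer :: 'r where
  "pseudo_uniformizer = (SOME a. a \<noteq> 0 \<and> \<not> a dvd 1)"

abbreviation "\<pi> \<equiv> pseudo_uniformizer"

lemma \<pi>_nonzero: "\<pi> \<noteq> 0" and \<pi>_not_unit: "\<not> \<pi> dvd 1"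
  using someI_ex[OF nontrivial] by (simp_all add: pseudo_uniformizer_def)

lemma nu_\<pi>_pos: "0 < nu (to_fract \<pi>)" and nu_\<pi>_less_one: "nu (to_fract \<pi>) < 1"
  using \<pi>_nonzero \<pi>_not_unit by (simp_all add: nu_pos not_dvd_one_iff)

text \<open>
  The two divisibility lemmas express that the valuation has rank one, through the Archimedean
  property of the reals.
\<close>

lemma power_dvd_pseudo_uniformizer:
  assumes "\<not> a dvd 1" shows "\<exists>n. \<pi> dvd a ^ n"
proof -
  obtain n where "nu (to_fract a) ^ n < nu (to_fract \<pi>)"
    using real_arch_pow_inv[OF nu_\<pi>_pos] assms by (auto simp: not_dvd_one_iff)
  moreover have "to_fract (a ^ n) = to_fract a ^ n" by (induction n) simp_all
  ultimately show ?thesis by (metis nu.power nu_le_iff_dvd order_less_imp_le)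
qed

lemma pseudo_uniformizer_power_dvd:
  assumes "d \<noteq> 0" shows "\<exists>n. d dvd \<pi> ^ n"
proof -
  obtain n where "nu (to_fract \<pi>) ^ n < nu (to_fract d)"
    using real_arch_pow_inv[OF nu_pos nu_\<pi>_less_one, of "to_fract d"] assms by auto
  moreover have "to_fract (\<pi> ^ n) = to_fract \<pi> ^ n" by (induction n) simp_all
  ultimately show ?thesis by (metis nu.power nu_le_iff_dvd order_less_imp_le)
qed

lemma common_denominator:
  fixes p :: "'r fract poly"
  obtains d q where "d \<noteq> 0" "smult (to_fract d) p = map_poly to_fract q"
proof -
  have "\<exists>d q. d \<noteq> 0 \<and> smult (to_fract d) p = map_poly to_fract q"
  proof (induction p)
    case 0
    show ?case by (rule exI[of _ 1], rule exI[of _ 0]) simp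
  next
    case (pCons c p)
    then obtain d q where dq: "d \<noteq> 0" "smult (to_fract d) p = map_poly to_fract q" by blast
    obtain x y where c: "c = to_fract x / to_fract y" "y \<noteq> 0"
      by (cases c) (auto simp: Fract_conv_to_fract)
    have "smult (to_fract (y * d)) (pCons c p)
        = pCons (to_fract (x * d)) (smult (to_fract y) (smult (to_fract d) p))"
      using c by simp
    also have "\<dots> = map_poly to_fract (pCons (x * d) (smult y q))"
      by (simp only: dq(2) map_poly_pCons[of to_fract, OF to_fract_0] fract_poly_smult)
    finally show ?case using c(2) dq(1) by (metis mult_eq_0_iff)
  qed
  then show ?thesis using that by blast
qed

lemma affine_line_field_iff:
  assumes "0 < \<omega>"
  shows "l \<in> affine_line (norm_power nu \<omega>) \<longleftrightarrow> 
    ultrametric_seminorm l \<and> (\<forall>a. l [:a:] \<le> nu a powr \<omega>)"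
  using ultrametric_seminorm.affine_line_iff[OF nu.powr_seminorm[OF assms]]
  by (simp add: norm_power_def)

lemma affine_line_field_const:
  assumes "0 < \<omega>" "l \<in> affine_line (norm_power nu \<omega>)"
  shows "l [:a:] = nu a powr \<omega>"
  using affine_line_const[OF nu.powr_seminorm[OF assms(1)]] assms(2) by (simp add: norm_power_def)

lemma ring_norm_seminorm: "ultrametric_seminorm (ring_norm nu)"
  using nu.comp_seminorm[of to_fract] by (simp add: o_def ring_norm_def[abs_def])

lemma affine_line_ring_iff:
  "l \<in> affine_line (ring_norm nu) \<longleftrightarrow>
    ultrametric_seminorm l \<and> (\<forall>a. l [:a:] \<le> nu (to_fract a))"
  using ultrametric_seminorm.affine_line_iff[OF ring_norm_seminorm] by (simp add: ring_norm_def)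

lemma affine_line_ring_unit:
  assumes l: "l \<in> affine_line (ring_norm nu)" and "a dvd 1"
  shows "l [:a:] = 1"
proof -
  interpret l: ultrametric_seminorm l using l by (simp add: affine_line_ring_iff)
  have le: "l [:b:] \<le> 1" for b
    using l nu_to_fract_le_one[of b] by (auto simp: affine_line_ring_iff intro: order_trans)
  obtain b where "1 = a * b" using assms(2) by (rule dvdE)
  then have "l [:a:] * l [:b:] = 1" by (simp add: l.one mult.commute flip: l.mult one_pCons)
  then show ?thesis
    using le[of a] le[of b] l.nonneg[of "[:a:]"] mult_left_le[of "l [:b:]" "l [:a:]"] by simp
qed

end

section \<open>The residue field\<close>

locale residue_valuation = rank_one_valuation nu
  for nu :: "'r::idom fract \<Rightarrow> real" +
  fixes Q :: "'r \<Rightarrow> 'f::field"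
  assumes residue: "residue_map Q"
begin

lemma Q_add: "Q (a + b) = Q a + Q b" and Q_mult: "Q (a * b) = Q a * Q b" and Q_1: "Q 1 = 1"
  and surj_Q: "surj Q" and Q_eq_0_iff: "Q a = 0 \<longleftrightarrow> \<not> a dvd 1"
  using residue by (simp_all add: residue_map_def)

lemma Q_0: "Q 0 = 0" using Q_add[of 0 0] by (metis add_0_right add_left_cancel)

lemma Q_minus: "Q (- a) = - Q a" using Q_add[of a "- a"] by (simp add: Q_0 add_eq_0_iff)

lemma Q_diff: "Q (a - b) = Q a - Q b" using Q_add[of a "- b"] by (simp add: Q_minus)

lemma Q_sum: "Q (sum f A) = (\<Sum>a\<in>A. Q (f a))"
  by (induction A rule: infinite_finite_induct) (auto simp: Q_0 Q_add)

abbreviation Q_poly :: "'r poly \<Rightarrow> 'f poly" where "Q_poly \<equiv> map_poly Q"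

lemma coeff_Q_poly: "coeff (Q_poly p) n = Q (coeff p n)"
  by (simp add: coeff_map_poly Q_0)

lemma Q_poly_0: "Q_poly 0 = 0"
  by simp

lemma Q_poly_add: "Q_poly (p + q) = Q_poly p + Q_poly q"
  and Q_poly_diff: "Q_poly (p - q) = Q_poly p - Q_poly q"
  by (rule poly_eqI; simp add: coeff_Q_poly Q_add Q_minus Q_diff)+

lemma Q_poly_mult: "Q_poly (p * q) = Q_poly p * Q_poly q"
  by (rule poly_eqI) (simp add: coeff_Q_poly coeff_mult Q_sum Q_mult)

lemma Q_poly_pCons: "Q_poly (pCons a p) = pCons (Q a) (Q_poly p)"
  by (rule poly_eqI) (simp add: coeff_Q_poly coeff_pCons split: nat.split)

lemma surj_Q_poly: "surj Q_poly"
proof -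
  have "\<exists>p. Q_poly p = q" for q
  proof (induction q)
    case 0
    then show ?case using Q_poly_0 by blast
  next
    case (pCons a q)
    then show ?case using surj_Q Q_poly_pCons by (metis surjD)
  qed
  then show ?thesis by (metis surjI)
qed

text \<open>
  If \<open>Q_poly p = 0\<close>, then \<open>p\<close> is a polynomial in \<open>t\<close> whose coefficients are non-units. So
  \<open>l p\<close> is small as soon as \<open>l\<close> is small on non-units and \<open>l t\<close> remains bounded.
\<close>

lemma tendsto_zero_on_kernel:
  fixes l :: "'i \<Rightarrow> 'r poly \<Rightarrow> real"
  assumes ev: "\<forall>\<^sub>F i in G. ultrametric_seminorm (l i)"
    and nonunit: "\<And>a. \<not> a dvd 1 \<Longrightarrow> ((\<lambda>i. l i [:a:]) \<longlongrightarrow> 0) G"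
    and t: "((\<lambda>i. l i [:0, 1:]) \<longlongrightarrow> \<tau>) G"
    and p: "Q_poly p = 0"
  shows "((\<lambda>i. l i p) \<longlongrightarrow> 0) G"
  using p
proof (induction p)
  case 0
  show ?case
    by (rule tendsto_eventually) (use ev in \<open>auto elim: eventually_mono intro: ultrametric_seminorm.zero\<close>)
next
  case (pCons a p)
  then have a: "\<not> a dvd 1" and p: "Q_poly p = 0" by (simp_all add: Q_poly_pCons Q_eq_0_iff)
  have lim: "((\<lambda>i. l i [:a:] + l i [:0, 1:] * l i p) \<longlongrightarrow> 0 + \<tau> * 0) G"
    by (intro tendsto_intros nonunit a t pCons.IH p)
  have bound: "l i (pCons a p) \<le> l i [:a:] + l i [:0, 1:] * l i p" "0 \<le> l i (pCons a p)"
    if "ultrametric_seminorm (l i)" for i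
  proof -
    interpret ultrametric_seminorm "l i" by fact
    have "pCons a p = [:a:] + [:0, 1:] * p" by simp
    then show "l i (pCons a p) \<le> l i [:a:] + l i [:0, 1:] * l i p" by (metis subadditive mult)
    show "0 \<le> l i (pCons a p)" by (rule nonneg)
  qed
  show ?case
    by (rule tendsto_sandwich[OF _ _ tendsto_const])
      (use ev bound lim in \<open>auto elim: eventually_mono\<close>)
qed

text \<open>
  The image of \<open>Q_affine Q\<close> consists of the seminorms that vanish on the maximal ideal: such a
  seminorm vanishes on the kernel of \<open>Q_poly\<close> and hence factors through \<open>Q_poly\<close>.
\<close>

lemma Q_affine_image:
  "Q_affine Q ` affine_line trivial_norm =
    {l \<in> affine_line (ring_norm nu). \<forall>a. \<not> a dvd 1 \<longrightarrow> l [:a:] = 0}"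
proof (intro subset_antisym subsetI)
  fix l assume "l \<in> Q_affine Q ` affine_line trivial_norm"
  then obtain \<mu> where \<mu>: "\<mu> \<in> affine_line trivial_norm" "l = \<mu> \<circ> Q_poly"
    by (auto simp: Q_affine_def)
  interpret \<mu>: ultrametric_seminorm \<mu> using \<mu>(1) by (simp add: affine_line_trivial)
  have "ultrametric_seminorm l" unfolding \<mu>(2)
    by (rule \<mu>.comp_seminorm) (simp_all add: Q_1 Q_poly_add Q_poly_mult)
  moreover have const: "l [:a:] = trivial_norm (Q a)" for a
    using affine_line_trivial_const[OF \<mu>(1)] by (simp add: \<mu>(2) Q_poly_pCons)
  moreover have "trivial_norm (Q a) \<le> nu (to_fract a)" for a
    using nu_to_fract_le_one[of a] nu.nonneg[of "to_fract a"]
    by (auto simp: trivial_norm_def Q_eq_0_iff dvd_one_iff)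
  ultimately show "l \<in> {l \<in> affine_line (ring_norm nu). \<forall>a. \<not> a dvd 1 \<longrightarrow> l [:a:] = 0}"
    by (simp add: affine_line_ring_iff trivial_norm_def Q_eq_0_iff)
next
  fix l assume l: "l \<in> {l \<in> affine_line (ring_norm nu). \<forall>a. \<not> a dvd 1 \<longrightarrow> l [:a:] = 0}"
  then interpret l: ultrametric_seminorm l by (simp add: affine_line_ring_iff)
  have "((\<lambda>_. l p) \<longlongrightarrow> 0) sequentially" if "Q_poly p = 0" for p
    by (rule tendsto_zero_on_kernel[where \<tau> = "l [:0, 1:]"])
      (use l that l.ultrametric_seminorm_axioms in auto)
  then have kernel: "l p = 0" if "Q_poly p = 0" for p using that by (simp add: LIMSEQ_const_iff)
  define \<mu> where "\<mu> q = l (inv Q_poly q)" for q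
  have \<mu>: "\<mu> (Q_poly p) = l p" for p
    using l.abs_diff_le[of "inv Q_poly (Q_poly p)" p] kernel[of "inv Q_poly (Q_poly p) - p"]
    by (simp add: \<mu>_def Q_poly_diff surj_f_inv_f[OF surj_Q_poly])
  have lift: "\<exists>p. q = Q_poly p" for q using surj_Q_poly by (metis surjD)
  have "ultrametric_seminorm \<mu>"
  proof
    fix p' q'
    obtain p q where pq: "p' = Q_poly p" "q' = Q_poly q" using lift by meson
    show "\<mu> (p' + q') \<le> max (\<mu> p') (\<mu> q')"
      by (simp add: pq \<mu> l.ultra flip: Q_poly_add)
    show "\<mu> (p' * q') = \<mu> p' * \<mu> q'"
      by (simp add: pq \<mu> l.mult flip: Q_poly_mult)
    show "0 \<le> \<mu> p'" by (simp add: pq \<mu> l.nonneg)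
    show "\<mu> 0 = 0" "\<mu> 1 = 1" using \<mu>[of 0] \<mu>[of 1] by (simp_all add: l.zero l.one Q_1)
  qed
  moreover have "\<mu> [:s:] \<le> trivial_norm s" for s
  proof -
    obtain a where a: "s = Q a" using surj_Q by (metis surjD)
    have "\<mu> [:s:] = l [:a:]" using \<mu>[of "[:a:]"] by (simp add: a Q_poly_pCons)
    moreover have "l [:a:] \<le> 1"
      using l nu_to_fract_le_one[of a] by (auto simp: affine_line_ring_iff intro: order_trans)
    ultimately show ?thesis using l by (auto simp: trivial_norm_def a Q_eq_0_iff)
  qed
  ultimately have "\<mu> \<in> affine_line trivial_norm" by (simp add: affine_line_trivial)
  moreover have "l = Q_affine Q \<mu>" by (auto simp: Q_affine_def \<mu>)
  ultimately show "l \<in> Q_affine Q ` affine_line trivial_norm" by blast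
qed

end

context rank_one_valuation
begin

text \<open>
  Some power of each non-unit is a multiple of \<open>\<pi>\<close>, so vanishing at \<open>\<pi>\<close> propagates to the maximal
  ideal.
\<close>

lemma vanishes_on_nonunits_iff:
  assumes l: "l \<in> affine_line (ring_norm nu)"
  shows "(\<forall>a. \<not> a dvd 1 \<longrightarrow> l [:a:] = 0) \<longleftrightarrow> l [:\<pi>:] = 0"
proof
  assume zero: "l [:\<pi>:] = 0"
  interpret l: ultrametric_seminorm l using l by (simp add: affine_line_ring_iff)
  show "\<forall>a. \<not> a dvd 1 \<longrightarrow> l [:a:] = 0"
  proof (intro allI impI)
    fix a :: 'r assume "\<not> a dvd 1"
    then obtain n b where "a ^ n = \<pi> * b" using power_dvd_pseudo_uniformizer by (metis dvdE)
    then have "l ([:a:] ^ n) = l [:\<pi>:] * l [:b:]"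
      by (simp add: poly_const_pow mult.commute flip: l.mult)
    then show "l [:a:] = 0" using zero by (simp add: l.power)
  qed
qed (use \<pi>_not_unit in blast)

end

section \<open>Seminorms that are non-zero on the maximal ideal\<close>

text \<open>
  Two reals with the same rational bounds are equal; the bounds are stated without fractions because
  they will come from comparisons of powers.
\<close>

lemma nonneg_real_eqI_nat_bounds:
  fixes x y :: real
  assumes "0 \<le> x" and "\<And>n m. real m \<le> real n * x \<Longrightarrow> real m \<le> real n * y"
    and "\<And>n m. real n * x \<le> real m \<Longrightarrow> real n * y \<le> real m"
  shows "x = y"
proof (rule ccontr)
  assume "x \<noteq> y"
  then obtain n where n: "1 < real n * \<bar>x - y\<bar>" using reals_Archimedean3[of "\<bar>x - y\<bar>"] by auto
  define m where "m = nat \<lfloor>real n * x\<rfloor>"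
  have "real m \<le> real n * x" "real n * x \<le> real (Suc m)"
    using assms(1) by (auto simp: m_def) linarith+
  then have "real m \<le> real n * y" "real n * y \<le> real (Suc m)" by (metis assms(2,3))+
  with \<open>real m \<le> real n * x\<close> \<open>real n * x \<le> real (Suc m)\<close>
  have "\<bar>real n * x - real n * y\<bar> \<le> 1" by linarith
  then show False using n by (simp add: abs_mult flip: right_diff_distrib)
qed

context rank_one_valuation
begin

definition generic_part :: "('r poly \<Rightarrow> real) set" where
  "generic_part = {l \<in> affine_line (ring_norm nu). l [:\<pi>:] \<noteq> 0}"

text \<open>
  On \<open>generic_part\<close> these are the components of the inverse of \<open>Lambda\<close>. If \<open>l\<close> comes from \<open>K\<close> with
  exponent \<open>\<omega>\<close>, then \<open>l \<pi> = nu \<pi> powr \<omega>\<close>, which determines \<open>\<omega>\<close>. The multiplicative extension to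
  \<open>K[t]\<close> is forced by clearing denominators; the choice of the denominator is immaterial by
  \<open>extension_eq\<close>.
\<close>

definition exponent :: "('r poly \<Rightarrow> real) \<Rightarrow> real" where
  "exponent l = ln (l [:\<pi>:]) / ln (nu (to_fract \<pi>))"

definition extension :: "('r poly \<Rightarrow> real) \<Rightarrow> 'r fract poly \<Rightarrow> real" where
  "extension l p = (SOME x. \<exists>d q. d \<noteq> 0 \<and> smult (to_fract d) p = map_poly to_fract q \<and> x = l q / l [:d:])"

definition Lambda_inverse :: "('r poly \<Rightarrow> real) \<Rightarrow> ('r fract poly \<Rightarrow> real) \<times> real" where
  "Lambda_inverse l = ((\<lambda>p. extension l p powr (1 / exponent l)), exponent l)"

lemma ln_nu_\<pi>: "ln (nu (to_fract \<pi>)) < 0"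
  using nu_\<pi>_pos nu_\<pi>_less_one by simp

lemma generic_part_seminorm: "l \<in> generic_part \<Longrightarrow> ultrametric_seminorm l"
  by (simp add: generic_part_def affine_line_ring_iff)

lemma generic_part_pos:
  assumes l: "l \<in> generic_part" and "d \<noteq> 0"
  shows "0 < l [:d:]"
proof -
  interpret l: ultrametric_seminorm l using l by (rule generic_part_seminorm)
  obtain n r where "\<pi> ^ n = d * r" using pseudo_uniformizer_power_dvd[OF assms(2)] by (metis dvdE)
  then have "l [:\<pi>:] ^ n = l [:d:] * l [:r:]"
    by (simp add: poly_const_pow mult.commute flip: l.power l.mult)
  moreover have "l [:\<pi>:] ^ n \<noteq> 0" using l by (simp add: generic_part_def)
  ultimately show ?thesis using l.nonneg[of "[:d:]"] by (cases "l [:d:] = 0") auto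
qed

text \<open>
  Divisibility in \<open>R\<close> is the order of the absolute values, so \<open>l\<close> inherits from \<open>nu\<close> all comparisons
  between powers of elements.
\<close>

lemma generic_part_power_mono:
  assumes l: "l \<in> generic_part" and le: "nu (to_fract a) ^ n \<le> nu (to_fract b) ^ m"
  shows "l [:a:] ^ n \<le> l [:b:] ^ m"
proof -
  interpret l: ultrametric_seminorm l using l by (rule generic_part_seminorm)
  have "to_fract (a ^ n) = to_fract a ^ n" for a :: 'r and n by (induction n) simp_all
  then have "b ^ m dvd a ^ n" using le by (metis nu.power nu_le_iff_dvd)
  then obtain r where "a ^ n = b ^ m * r" by (rule dvdE)
  then have "l [:a:] ^ n = l [:b:] ^ m * l [:r:]"
    by (simp add: poly_const_pow mult.commute flip: l.power l.mult)
  moreover have "l [:r:] \<le> 1"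
    using l nu_to_fract_le_one[of r]
    by (auto simp: generic_part_def affine_line_ring_iff intro: order_trans)
  ultimately show ?thesis by (simp add: l.nonneg mult_left_le)
qed

lemma exponent_ge_one:
  assumes l: "l \<in> generic_part"
  shows "1 \<le> exponent l"
proof -
  have "l [:\<pi>:] \<le> nu (to_fract \<pi>)" using l by (simp add: generic_part_def affine_line_ring_iff)
  then have "ln (l [:\<pi>:]) \<le> ln (nu (to_fract \<pi>))"
    using generic_part_pos[OF l \<pi>_nonzero] nu_\<pi>_pos by simp
  then show ?thesis using ln_nu_\<pi> by (simp add: exponent_def le_divide_eq)
qed

text \<open>
  Comparing \<open>a ^ n\<close> with \<open>\<pi> ^ m\<close> for all \<open>n\<close> and \<open>m\<close> shows that the logarithm of \<open>a\<close> to the base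
  \<open>\<pi>\<close> satisfies the same rational bounds whether it is measured by \<open>nu\<close> or by \<open>l\<close>.
\<close>

lemma generic_part_const:
  assumes l: "l \<in> generic_part"
  shows "l [:a:] = nu (to_fract a) powr exponent l"
proof (cases "a = 0")
  case True
  then show ?thesis
    using ultrametric_seminorm.zero[OF generic_part_seminorm[OF l]] by (simp add: nu.zero)
next
  case False
  define x where "x = ln (nu (to_fract a)) / ln (nu (to_fract \<pi>))"
  define y where "y = ln (l [:a:]) / ln (l [:\<pi>:])"
  have pos: "0 < l [:a:]" "0 < l [:\<pi>:]" "0 < nu (to_fract a)" "0 < nu (to_fract \<pi>)"
    using generic_part_pos[OF l] False \<pi>_nonzero by (simp_all add: nu_pos)
  have "l [:\<pi>:] \<le> nu (to_fract \<pi>)" using l by (simp add: generic_part_def affine_line_ring_iff)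
  then have ln: "ln (l [:\<pi>:]) < 0" using pos nu_\<pi>_less_one by simp
  have power_le: "u ^ n \<le> v ^ m \<longleftrightarrow> real n * ln u \<le> real m * ln v" if "0 < u" "0 < v" for u v n m
    using that ln_le_cancel_iff[of "u ^ n" "v ^ m"] by (simp add: ln_realpow)
  have "x = y"
  proof (rule nonneg_real_eqI_nat_bounds)
    have "ln (nu (to_fract a)) \<le> 0" using nu_to_fract_le_one[of a] pos by simp
    then show "0 \<le> x" using ln_nu_\<pi> by (simp add: x_def zero_le_divide_iff)
  next
    fix n m assume "real m \<le> real n * x"
    then have "nu (to_fract a) ^ n \<le> nu (to_fract \<pi>) ^ m"
      using ln_nu_\<pi> pos by (simp add: x_def power_le field_simps)
    then have "l [:a:] ^ n \<le> l [:\<pi>:] ^ m" by (rule generic_part_power_mono[OF l])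
    then show "real m \<le> real n * y" using pos ln by (simp add: y_def power_le field_simps)
  next
    fix n m assume "real n * x \<le> real m"
    then have "nu (to_fract \<pi>) ^ m \<le> nu (to_fract a) ^ n"
      using ln_nu_\<pi> pos by (simp add: x_def power_le field_simps)
    then have "l [:\<pi>:] ^ m \<le> l [:a:] ^ n" by (rule generic_part_power_mono[OF l])
    then show "real n * y \<le> real m" using pos ln by (simp add: y_def power_le field_simps)
  qed
  then have "ln (l [:a:]) = exponent l * ln (nu (to_fract a))"
    using ln ln_nu_\<pi> by (simp add: x_def y_def exponent_def field_simps)
  then have "exp (ln (l [:a:])) = exp (exponent l * ln (nu (to_fract a)))" by simp
  then show ?thesis using pos False by (simp add: powr_def)
qed

lemma extension_eq:
  assumes l: "l \<in> generic_part" and "d \<noteq> 0" "smult (to_fract d) p = map_poly to_fract q"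
  shows "extension l p = l q / l [:d:]"
  unfolding extension_def
proof (rule some_equality)
  interpret l: ultrametric_seminorm l using l by (rule generic_part_seminorm)
  fix x assume "\<exists>d q. d \<noteq> 0 \<and> smult (to_fract d) p = map_poly to_fract q \<and> x = l q / l [:d:]"
  then obtain e r where er: "e \<noteq> 0" "smult (to_fract e) p = map_poly to_fract r" "x = l r / l [:e:]"
    by blast
  have "map_poly to_fract (smult e q) = smult (to_fract e) (smult (to_fract d) p)"
    by (simp add: assms(3))
  also have "\<dots> = smult (to_fract d) (smult (to_fract e) p)" by (simp add: mult.commute)
  also have "\<dots> = map_poly to_fract (smult d r)" by (simp add: er(2))
  finally have "[:e:] * q = [:d:] * r" by (simp del: fract_poly_smult)
  then have "l [:e:] * l q = l [:d:] * l r" by (metis l.mult)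
  then show "x = l q / l [:d:]"
    unfolding er(3) using generic_part_pos[OF l er(1)] generic_part_pos[OF l assms(2)]
    by (subst frac_eq_eq) (auto simp: mult.commute)
qed (use assms in blast)

lemma extension_fract_poly: "l \<in> generic_part \<Longrightarrow> extension l (map_poly to_fract p) = l p"
  using extension_eq[of l 1 _ p] generic_part_seminorm[of l]
  by (simp add: ultrametric_seminorm.one flip: one_pCons)

lemma extension_const:
  assumes l: "l \<in> generic_part"
  shows "extension l [:c:] = nu c powr exponent l"
proof -
  interpret l: ultrametric_seminorm l using l by (rule generic_part_seminorm)
  obtain x y where c: "c = to_fract x / to_fract y" "y \<noteq> 0"
    by (cases c) (auto simp: Fract_conv_to_fract)
  have "nu c * nu (to_fract y) = nu (to_fract x)" using c by (simp flip: nu.mult)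
  then have nu: "nu c = nu (to_fract x) / nu (to_fract y)"
    using c(2) nu_pos[of "to_fract y"] by (simp add: field_simps)
  have "extension l [:c:] = l [:x:] / l [:y:]"
    by (rule extension_eq[OF l c(2)]) (use c in \<open>simp add: map_poly_pCons\<close>)
  then show ?thesis by (simp add: nu generic_part_const[OF l] powr_divide nu.nonneg)
qed

lemma extension_seminorm:
  assumes l: "l \<in> generic_part"
  shows "ultrametric_seminorm (extension l)"
proof
  interpret l: ultrametric_seminorm l using l by (rule generic_part_seminorm)
  fix p q :: "'r fract poly"
  obtain d p' where p: "d \<noteq> 0" "smult (to_fract d) p = map_poly to_fract p'"
    by (rule common_denominator)
  obtain e q' where q: "e \<noteq> 0" "smult (to_fract e) q = map_poly to_fract q'"
    by (rule common_denominator)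
  note eq = extension_eq[OF l p] extension_eq[OF l q]
  note pos = generic_part_pos[OF l p(1)] generic_part_pos[OF l q(1)]
  have const: "l [:d * e:] = l [:d:] * l [:e:]" by (simp add: mult.commute flip: l.mult)
  show "0 \<le> extension l p" by (simp add: eq l.nonneg)
  show "extension l 0 = 0" "extension l 1 = 1"
    using extension_fract_poly[OF l, of 0] extension_fract_poly[OF l, of 1]
    by (simp_all add: l.zero l.one)
  have "smult (to_fract (d * e)) (p * q) = smult (to_fract d) p * smult (to_fract e) q"
    by (simp add: mult.commute)
  also have "\<dots> = map_poly to_fract (p' * q')" by (simp add: p q)
  finally have "extension l (p * q) = l (p' * q') / l [:d * e:]"
    by (intro extension_eq[OF l]) (use p q in auto)
  then show "extension l (p * q) = extension l p * extension l q"
    by (simp add: eq const l.mult)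
  have "smult (to_fract (d * e)) (p + q)
      = smult (to_fract e) (smult (to_fract d) p) + smult (to_fract d) (smult (to_fract e) q)"
    by (simp add: mult.commute smult_add_right)
  also have "\<dots> = map_poly to_fract ([:e:] * p' + [:d:] * q')" by (simp add: p q)
  finally have "extension l (p + q) = l ([:e:] * p' + [:d:] * q') / l [:d * e:]"
    by (intro extension_eq[OF l]) (use p q in auto)
  also have "\<dots> \<le> max (l [:e:] * l p') (l [:d:] * l q') / (l [:d:] * l [:e:])"
    using l.ultra[of "[:e:] * p'" "[:d:] * q'"] pos unfolding const
    by (intro divide_right_mono) (auto simp only: l.mult intro: mult_nonneg_nonneg)
  also have "\<dots> = max (extension l p) (extension l q)"
    using pos by (auto simp: eq max_def field_simps)
  finally show "extension l (p + q) \<le> max (extension l p) (extension l q)" .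
qed

lemma norm_power_in_affine_line:
  assumes "m \<in> affine_line nu" "1 \<le> \<omega>"
  shows "norm_power m \<omega> \<in> affine_line (norm_power nu \<omega>)"
proof -
  have "ultrametric_seminorm (\<lambda>x. m x powr \<omega>)"
    using assms by (intro ultrametric_seminorm.powr_seminorm) (auto simp: nu.affine_line_iff)
  moreover have "m [:a:] = nu a" for a
    using affine_line_const[OF nu.ultrametric_seminorm_axioms assms(1)] .
  ultimately show ?thesis using assms(2) by (simp add: affine_line_field_iff) (simp add: norm_power_def)
qed

lemma J_affine_in_generic_part:
  assumes l: "l \<in> affine_line (norm_power nu \<omega>)" and \<omega>: "1 \<le> \<omega>"
  shows "J_affine l \<in> generic_part"
proof -
  have const: "J_affine l [:a:] = nu (to_fract a) powr \<omega>" for a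
    using affine_line_field_const[of \<omega> l] l \<omega> by (simp add: J_affine_def map_poly_pCons)
  have "ultrametric_seminorm (J_affine l)"
    unfolding J_affine_def
    by (rule ultrametric_seminorm.comp_seminorm) (use l \<omega> in \<open>simp_all add: affine_line_field_iff\<close>)
  moreover have "nu (to_fract a) powr \<omega> \<le> nu (to_fract a)" for a
  proof (cases "a = 0")
    case False
    then have "nu (to_fract a) powr \<omega> \<le> nu (to_fract a) powr 1"
      using nu_to_fract_le_one[of a] \<omega> nu_pos[of "to_fract a"] by (intro powr_mono') auto
    then show ?thesis by (simp add: nu.nonneg)
  qed (simp add: nu.zero)
  ultimately show ?thesis
    using \<pi>_nonzero by (simp add: generic_part_def affine_line_ring_iff const)
qed

lemma Lambda_in_generic_part:
  assumes "m \<in> affine_line nu" "1 \<le> \<omega>"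
  shows "Lambda (m, \<omega>) \<in> generic_part"
  using J_affine_in_generic_part[OF norm_power_in_affine_line] assms by (simp add: Lambda_def)

lemma Lambda_inverse_Lambda:
  assumes m: "m \<in> affine_line nu" and \<omega>: "1 \<le> \<omega>"
  shows "Lambda_inverse (Lambda (m, \<omega>)) = (m, \<omega>)"
proof -
  define l where "l = Lambda (m, \<omega>)"
  have l: "l \<in> generic_part" using Lambda_in_generic_part assms by (simp add: l_def)
  interpret m: ultrametric_seminorm m using m by (simp add: nu.affine_line_iff)
  have l_eq: "l p = m (map_poly to_fract p) powr \<omega>" for p
    by (simp add: l_def Lambda_def J_affine_def norm_power_def)
  have const: "m [:a:] = nu a" for a
    using affine_line_const[OF nu.ultrametric_seminorm_axioms m] .
  have exponent: "exponent l = \<omega>"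
    using nu_\<pi>_pos nu_\<pi>_less_one by (simp add: exponent_def l_eq map_poly_pCons const)
  have "extension l p powr (1 / \<omega>) = m p" for p
  proof -
    obtain d q where dq: "d \<noteq> 0" "smult (to_fract d) p = map_poly to_fract q"
      by (rule common_denominator)
    have "m (map_poly to_fract q) = m [:to_fract d:] * m p"
      by (simp flip: dq(2) m.mult)
    then have "extension l p = m p powr \<omega>"
      using extension_eq[OF l dq] nu_pos[of "to_fract d"] dq(1)
      by (simp add: l_eq map_poly_pCons const m.nonneg powr_mult)
    then show ?thesis using \<omega> by (simp add: powr_powr m.nonneg)
  qed
  then show ?thesis by (simp add: Lambda_inverse_def exponent flip: l_def)
qed

lemma Lambda_inverse_in:
  assumes l: "l \<in> generic_part"
  shows "Lambda_inverse l \<in> affine_line nu \<times> {1..}"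
proof -
  have "0 < exponent l" using exponent_ge_one[OF l] by simp
  moreover from this have "ultrametric_seminorm (\<lambda>p. extension l p powr (1 / exponent l))"
    by (intro ultrametric_seminorm.powr_seminorm extension_seminorm l) simp
  ultimately show ?thesis using exponent_ge_one[OF l]
    by (simp add: Lambda_inverse_def nu.affine_line_iff extension_const[OF l] powr_powr nu.nonneg)
qed

lemma Lambda_Lambda_inverse:
  assumes l: "l \<in> generic_part"
  shows "Lambda (Lambda_inverse l) = l"
proof
  fix p
  show "Lambda (Lambda_inverse l) p = l p"
    using exponent_ge_one[OF l] ultrametric_seminorm.nonneg[OF generic_part_seminorm[OF l], of p]
    by (simp add: Lambda_inverse_def Lambda_def J_affine_def norm_power_def extension_fract_poly[OF l]
        powr_powr)
qed

lemma Lambda_image: "Lambda ` (affine_line nu \<times> {1..}) = generic_part"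
proof (intro subset_antisym subsetI)
  fix l assume "l \<in> generic_part"
  then show "l \<in> Lambda ` (affine_line nu \<times> {1..})"
    using Lambda_Lambda_inverse Lambda_inverse_in by (metis imageI)
qed (use Lambda_in_generic_part in auto)

lemma J_affine_image: "(\<Union>\<omega>\<in>{1..}. J_affine ` affine_line (norm_power nu \<omega>)) = generic_part"
proof (intro subset_antisym subsetI)
  fix l assume "l \<in> generic_part"
  then obtain m \<omega> where "m \<in> affine_line nu" "1 \<le> \<omega>" "l = Lambda (m, \<omega>)"
    using Lambda_image by force
  then show "l \<in> (\<Union>\<omega>\<in>{1..}. J_affine ` affine_line (norm_power nu \<omega>))"
    using norm_power_in_affine_line by (auto simp: Lambda_def)
qed (use J_affine_in_generic_part in auto)

end

lemma affine_line_topology_eq: "affine_line_topology N = top_of_set (affine_line N)"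
  by (simp add: affine_line_topology_def euclidean_product_topology)

lemma continuous_on_fst_apply: "continuous_on A (\<lambda>x :: ('a \<Rightarrow> real) \<times> real. fst x q)"
  by (rule continuous_on_product_then_coordinatewise) (intro continuous_intros)

context rank_one_valuation
begin

lemma continuous_on_Lambda: "continuous_on (affine_line nu \<times> {1..}) Lambda"
proof (rule continuous_on_coordinatewise_then_product)
  fix p :: "'r poly"
  have "continuous_on (affine_line nu \<times> {1..})
      (\<lambda>x :: ('r fract poly \<Rightarrow> real) \<times> real. fst x (map_poly to_fract p) powr snd x)"
    by (intro continuous_on_powr' continuous_on_fst_apply continuous_intros)
      (auto simp: affine_line_def)
  then show "continuous_on (affine_line nu \<times> {1..}) (\<lambda>x. Lambda x p)"
    by (simp add: Lambda_def J_affine_def norm_power_def split_beta)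
qed

text \<open>
  For a fixed polynomial one denominator serves all \<open>l\<close> simultaneously, so each coordinate of the
  inverse is an explicit continuous expression in finitely many values of \<open>l\<close>.
\<close>

lemma continuous_on_Lambda_inverse: "continuous_on generic_part Lambda_inverse"
  unfolding Lambda_inverse_def
proof (intro continuous_on_Pair continuous_on_coordinatewise_then_product)
  have coord: "continuous_on generic_part (\<lambda>l :: 'r poly \<Rightarrow> real. l q)" for q
    by (rule continuous_on_subset[OF continuous_on_product_coordinates]) simp
  have pos: "0 < l [:d:]" if "l \<in> generic_part" "d \<noteq> 0" for l d
    using generic_part_pos that by blast
  show exponent: "continuous_on generic_part exponent"
    unfolding exponent_def using pos \<pi>_nonzero ln_nu_\<pi>
    by (intro continuous_intros coord) fastforce+
  fix p :: "'r fract poly"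
  obtain d q where dq: "d \<noteq> 0" "smult (to_fract d) p = map_poly to_fract q"
    by (rule common_denominator)
  have "continuous_on generic_part (\<lambda>l. (l q / l [:d:]) powr (1 / exponent l))"
  proof (intro continuous_on_powr' continuous_on_divide coord exponent continuous_on_const ballI)
    fix l assume l: "l \<in> generic_part"
    show "l [:d:] \<noteq> 0" using pos[OF l dq(1)] by simp
    show "exponent l \<noteq> 0" using exponent_ge_one[OF l] by simp
    show "0 \<le> l q / l [:d:] \<and> (l q / l [:d:] = 0 \<longrightarrow> 0 < 1 / exponent l)"
      using pos[OF l dq(1)] exponent_ge_one[OF l]
        ultrametric_seminorm.nonneg[OF generic_part_seminorm[OF l], of q] by simp
  qed
  then show "continuous_on generic_part (\<lambda>l. extension l p powr (1 / exponent l))"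
    by (rule continuous_on_eq) (simp add: extension_eq[OF _ dq])
qed

lemma generic_part_subset: "generic_part \<subseteq> affine_line (ring_norm nu)"
  by (auto simp: generic_part_def)

lemma homeomorphic_map_Lambda:
  "homeomorphic_map
     (prod_topology (affine_line_topology nu) (top_of_set {1..}))
     (subtopology (affine_line_topology (ring_norm nu)) generic_part) Lambda"
proof -
  have "prod_topology (affine_line_topology nu) (top_of_set {1::real..})
      = top_of_set (affine_line nu \<times> {1..})"
    by (simp add: affine_line_topology_eq)
  moreover have "subtopology (affine_line_topology (ring_norm nu)) generic_part = top_of_set generic_part"
    using generic_part_subset by (simp add: affine_line_topology_eq subtopology_subtopology inf_absorb2)
  moreover have "homeomorphic_maps (top_of_set (affine_line nu \<times> {1..})) (top_of_set generic_part)
      Lambda Lambda_inverse"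
    using continuous_on_Lambda continuous_on_Lambda_inverse Lambda_image Lambda_inverse_in
      Lambda_inverse_Lambda Lambda_Lambda_inverse
    by (auto simp: homeomorphic_maps_def continuous_map_iff_continuous continuous_map_in_subtopology)
  ultimately show ?thesis by (metis homeomorphic_map_maps)
qed

lemma openin_generic_part: "openin (affine_line_topology (ring_norm nu)) generic_part"
proof -
  have "open {l :: 'r poly \<Rightarrow> real. l [:\<pi>:] \<noteq> 0}"
    by (intro open_Collect_neq continuous_on_product_coordinates continuous_on_const)
  then show ?thesis
    by (auto simp: affine_line_topology_eq openin_open generic_part_def)
qed

lemma closedin_not_generic_part:
  "closedin (affine_line_topology (ring_norm nu)) (affine_line (ring_norm nu) - generic_part)"
  using openin_generic_part by (simp add: closedin_def affine_line_topology_eq double_diff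
      generic_part_subset)

end

lemma (in residue_valuation) Q_affine_image_eq:
  "Q_affine Q ` affine_line trivial_norm = affine_line (ring_norm nu) - generic_part"
  unfolding Q_affine_image generic_part_def using vanishes_on_nonunits_iff by blast

section \<open>Algebraically closed fields of fractions\<close>

locale alg_closed_valuation = residue_valuation nu Q
  for nu :: "'r::idom fract \<Rightarrow> real" and Q :: "'r \<Rightarrow> 'f::field" +
  assumes alg_closed: "algebraically_closed_field TYPE('r fract)"
begin

lemma root_exists:
  fixes x :: "'r fract"
  assumes "0 < n" obtains y where "y ^ n = x"
proof -
  have "degree (monom 1 n - [:x:]) = n"
    using assms degree_add_eq_left[of "[:- x:]" "monom 1 n"]
    by (simp add: degree_monom_eq diff_conv_add_uminus del: add_uminus_conv_diff)
  then obtain y where "poly (monom 1 n - [:x:]) y = 0"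
    using alg_closed assms by (metis algebraically_closed_field_def)
  then show ?thesis using that by (simp add: poly_monom)
qed

text \<open>
  Roots of powers of \<open>\<pi>\<close> realise every rational power of \<open>nu \<pi>\<close> as an absolute value.
\<close>

lemma nu_dense:
  assumes "0 \<le> x" "x < y"
  obtains e where "x < nu e" "nu e < y"
proof -
  define x' where "x' = max x (y / 2)"
  have x': "0 < x'" "x \<le> x'" "x' < y" using assms by (auto simp: x'_def)
  define q where "q = ln (nu (to_fract \<pi>))"
  have q: "q < 0" using ln_nu_\<pi> by (simp add: q_def)
  have "ln y / q < ln x' / q" using x' q by (simp add: divide_strict_right_mono_neg)
  then obtain r where r: "r \<in> \<rat>" "ln y / q < r" "r < ln x' / q" using Rats_dense_in_real by blast
  obtain m :: int and n :: nat where mn: "r = of_int m / of_nat n" "n \<noteq> 0"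
    using r(1) by (auto simp: Rats_eq_int_div_nat)
  obtain e where e: "e ^ n = to_fract \<pi> powi m" using root_exists mn(2) by blast
  then have nu_e: "nu e ^ n = nu (to_fract \<pi>) powi m" by (metis nu.power nu_power_int)
  have pos: "0 < nu e" using e mn(2) \<pi>_nonzero by (intro nu_pos) (auto simp: power_int_0_left_if power_0_left)
  have "real n * ln (nu e) = ln (nu e ^ n)" by (simp add: ln_realpow pos)
  also have "\<dots> = real_of_int m * q"
    using nu_\<pi>_pos powr_real_of_int'[of "nu (to_fract \<pi>)" m] ln_powr[of "nu (to_fract \<pi>)" "real_of_int m"]
    unfolding nu_e q_def using \<pi>_nonzero by simp
  also have "\<dots> = real n * (r * q)" using mn by simp
  finally have "ln (nu e) = r * q" using mn(2) by simp
  moreover have "ln x' < r * q" "r * q < ln y" using r q by (simp_all add: field_simps)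
  ultimately have "x' < nu e" "nu e < y"
    using pos x' ln_less_cancel_iff[of x' "nu e"] ln_less_cancel_iff[of "nu e" y] by simp_all
  then show ?thesis using that[of e] x' by simp
qed

lemma poly_Q_poly: "poly (Q_poly p) (Q a) = Q (poly p a)"
  by (induction p) (simp_all add: Q_0 Q_poly_pCons Q_add Q_mult)

lemma poly_fract_poly: "poly (map_poly to_fract p) (to_fract a) = to_fract (poly p a)"
  by (induction p) (simp_all add: map_poly_pCons)

text \<open>If \<open>nu x > 1\<close>, then the leading term \<open>x ^ n\<close> would strictly dominate all others.\<close>

lemma monic_root_integral:
  assumes "lead_coeff p = 1" "0 < degree p" and root: "poly (map_poly to_fract p) x = 0"
  shows "nu x \<le> 1"
proof (rule ccontr)
  assume x: "\<not> nu x \<le> 1"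
  define n where "n = degree p"
  define c where "c k = to_fract (coeff p k)" for k
  have sum: "nu (sum f A) \<le> B" if "\<And>k. k \<in> A \<Longrightarrow> nu (f k) \<le> B" "0 \<le> B" for f and A :: "nat set" and B
    using that
  proof (induction A rule: infinite_finite_induct)
    case (insert k A)
    then have "nu (f k) \<le> B" "nu (sum f A) \<le> B" by auto
    then show ?case using nu.ultra[of "f k" "sum f A"] insert.hyps by simp
  qed (simp_all add: nu.zero)
  have "degree (map_poly to_fract p) = n" by (simp add: n_def degree_map_poly)
  then have "0 = (\<Sum>k\<le>n. c k * x ^ k)"
    using root by (simp add: poly_altdef c_def coeff_map_poly)
  also have "\<dots> = x ^ n + (\<Sum>k<n. c k * x ^ k)"
    using assms(1) by (simp add: lessThan_Suc_atMost[symmetric] c_def n_def)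
  finally have "x ^ n = - (\<Sum>k<n. c k * x ^ k)" by (simp add: eq_neg_iff_add_eq_0)
  then have "nu x ^ n = nu (\<Sum>k<n. c k * x ^ k)" by (metis nu.minus nu.power)
  also have "\<dots> \<le> nu x ^ (n - 1)"
  proof (rule sum)
    fix k assume "k \<in> {..<n}"
    then have "nu x ^ k \<le> nu x ^ (n - 1)" using x by (intro power_increasing) auto
    moreover have "nu (c k) * nu x ^ k \<le> 1 * nu x ^ k"
      unfolding c_def by (intro mult_right_mono nu_to_fract_le_one zero_le_power nu.nonneg)
    ultimately show "nu (c k * x ^ k) \<le> nu x ^ (n - 1)" by (simp add: nu.mult nu.power)
  qed (simp add: nu.nonneg)
  also have "\<dots> < nu x ^ n" using x assms(2) by (intro power_strict_increasing) (auto simp: n_def)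
  finally show False by simp
qed

text \<open>
  A monic polynomial over the residue field lifts to a monic polynomial over \<open>R\<close>; its root in \<open>K\<close>
  is integral and can be reduced.
\<close>

lemma residue_field_algebraically_closed: "algebraically_closed_field TYPE('f)"
  unfolding algebraically_closed_field_def
proof (intro allI impI)
  fix p :: "'f poly" assume deg: "0 < degree p"
  define p1 where "p1 = smult (inverse (lead_coeff p)) p"
  have p1: "degree p1 = degree p" "lead_coeff p1 = 1" using deg by (auto simp: p1_def)
  \<comment> \<open>The section respects 0 and 1, so that lifting coefficients keeps the degree and monicity.\<close>
  define s where "s y = (if y = 0 then 0 else if y = 1 then 1 else inv Q y)" for y
  have Qs: "Q (s y) = y" for y by (simp add: s_def Q_0 Q_1 surj_f_inv_f[OF surj_Q])
  have s0: "s 0 = 0" by (simp add: s_def)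
  have s_nz: "y \<noteq> 0 \<Longrightarrow> s y \<noteq> 0" for y using Qs[of y] Q_0 by auto
  define P where "P = map_poly s p1"
  have degP: "degree P = degree p" unfolding P_def using s_nz p1 by (subst degree_map_poly) auto
  have lc: "lead_coeff P = 1" using p1 degP by (simp add: P_def coeff_map_poly s0) (simp add: s_def)
  have QP: "Q_poly P = p1" by (rule poly_eqI) (simp add: coeff_Q_poly P_def coeff_map_poly s0 Qs)
  have "degree (map_poly to_fract P) = degree p" by (simp add: degree_map_poly degP)
  then obtain x where x: "poly (map_poly to_fract P) x = 0"
    using alg_closed deg by (metis algebraically_closed_field_def)
  then obtain a where "x = to_fract a"
    using in_range_to_fract monic_root_integral[OF lc _ x] degP deg by auto
  then have "poly P a = 0" using x by (simp add: poly_fract_poly)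
  then have "poly p1 (Q a) = 0" using poly_Q_poly[of P a] by (simp add: QP Q_0)
  then have "poly p (Q a) = 0" using deg by (auto simp: p1_def)
  then show "\<exists>x. poly p x = 0" by blast
qed

end

section \<open>Convergence to points over the residue field\<close>

text \<open>
  Working along an arbitrary filter covers both nets and the sequences of classical points that are
  constructed for the density statement.
\<close>

locale seminorm_net = alg_closed_valuation nu Q
  for nu :: "'r::idom fract \<Rightarrow> real" and Q :: "'r \<Rightarrow> 'f::field" +
  fixes G :: "'i filter" and lam :: "'i \<Rightarrow> 'r fract poly \<Rightarrow> real" and \<omega> :: "'i \<Rightarrow> real" and C :: "'r set"
  assumes G: "G \<noteq> bot"
    and net: "\<forall>\<^sub>F i in G. lam i \<in> affine_line nu \<and> 1 \<le> \<omega> i"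
    and representatives: "Q ` C = UNIV"
begin

abbreviation "l i \<equiv> Lambda (lam i, \<omega> i)"

lemma representative: obtains c where "c \<in> C" "s = Q c"
proof -
  have "s \<in> Q ` C" using representatives by simp
  then show ?thesis using that by auto
qed

lemma l_eq: "l i p = lam i (map_poly to_fract p) powr \<omega> i"
  by (simp add: Lambda_def J_affine_def norm_power_def)

lemma eventually_l: "\<forall>\<^sub>F i in G. l i \<in> affine_line (ring_norm nu)"
  using net by eventually_elim (use Lambda_in_generic_part generic_part_subset in blast)

lemma eventually_seminorm: "\<forall>\<^sub>F i in G. ultrametric_seminorm (l i)"
  using eventually_l by eventually_elim (simp add: affine_line_ring_iff)

lemma eventually_const: "\<forall>\<^sub>F i in G. \<forall>a. l i [:a:] = nu (to_fract a) powr \<omega> i"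
  using net
  by eventually_elim
    (auto simp: l_eq map_poly_pCons affine_line_const[OF nu.ultrametric_seminorm_axioms])

lemma tendsto_of_diff:
  assumes "((\<lambda>i. l i p) \<longlongrightarrow> x) G" "((\<lambda>i. l i (p - q)) \<longlongrightarrow> 0) G"
  shows "((\<lambda>i. l i q) \<longlongrightarrow> x) G"
proof -
  have "((\<lambda>i. l i q - l i p) \<longlongrightarrow> 0) G"
  proof (rule Lim_null_comparison[OF _ assms(2)])
    show "\<forall>\<^sub>F i in G. norm (l i q - l i p) \<le> l i (p - q)"
      using eventually_seminorm
      by eventually_elim
        (metis ultrametric_seminorm.abs_diff_le ultrametric_seminorm.minus_commute real_norm_def)
  qed
  from tendsto_add[OF assms(1) this] show ?thesis by simp
qed

text \<open>
  Every \<open>p\<close> over \<open>R\<close> is congruent modulo the maximal ideal to a product of a constant and factors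
  \<open>t - c\<close> with \<open>c \<in> C\<close>, because the residue field is algebraically closed. The error tends to 0, so
  limits at the linear polynomials give limits everywhere, and a pointwise limit of
  seminorms is a seminorm.
\<close>

lemma converges_if_linear_converge:
  assumes nonunit: "\<And>a. \<not> a dvd 1 \<Longrightarrow> ((\<lambda>i. l i [:a:]) \<longlongrightarrow> 0) G"
    and linear: "\<And>c. c \<in> C \<Longrightarrow> ((\<lambda>i. l i [:- c, 1:]) \<longlongrightarrow> g c) G"
  shows "\<exists>\<mu>\<in>affine_line trivial_norm. \<forall>p. ((\<lambda>i. l i p) \<longlongrightarrow> \<mu> (Q_poly p)) G"
proof -
  obtain c0 where c0: "c0 \<in> C" "0 = Q c0" by (rule representative)
  have "((\<lambda>i. l i ([:- c0, 1:] - [:0, 1:])) \<longlongrightarrow> 0) G"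
    using nonunit[of "- c0"] c0(2)[symmetric] by (simp add: Q_eq_0_iff)
  then have t: "((\<lambda>i. l i [:0, 1:]) \<longlongrightarrow> g c0) G" by (rule tendsto_of_diff[OF linear[OF c0(1)]])
  have congruent: "((\<lambda>i. l i q) \<longlongrightarrow> x) G" if "((\<lambda>i. l i p) \<longlongrightarrow> x) G" "Q_poly p = Q_poly q" for p q x
    by (rule tendsto_of_diff[OF that(1) tendsto_zero_on_kernel[OF eventually_seminorm nonunit t]])
      (simp_all add: Q_poly_diff that(2))
  have "\<forall>p. Q_poly p = q \<longrightarrow> (\<exists>x. ((\<lambda>i. l i p) \<longlongrightarrow> x) G)" for q
    using residue_field_algebraically_closed
  proof (induction q rule: algebraically_closed_induct)
    case (const s)
    obtain a where a: "s = Q a" using surj_Q by (metis surjD)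
    have "\<exists>x. ((\<lambda>i. l i [:a:]) \<longlongrightarrow> x) G"
    proof (cases "a dvd 1")
      case True
      have "\<forall>\<^sub>F i in G. l i [:a:] = 1"
        using eventually_l by eventually_elim (rule affine_line_ring_unit[OF _ True])
      then show ?thesis by (intro exI[of _ 1] tendsto_eventually)
    qed (use nonunit in blast)
    then obtain x where x: "((\<lambda>i. l i [:a:]) \<longlongrightarrow> x) G" ..
    show ?case
    proof (intro allI impI exI)
      fix p assume "Q_poly p = [:s:]"
      then show "((\<lambda>i. l i p) \<longlongrightarrow> x) G" by (intro congruent[OF x]) (simp add: a Q_poly_pCons)
    qed
  next
    case (linear s)
    obtain c where c: "c \<in> C" "s = Q c" by (rule representative)
    show ?case
    proof (intro allI impI exI)
      fix p assume "Q_poly p = [:- s, 1:]"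
      then show "((\<lambda>i. l i p) \<longlongrightarrow> g c) G"
        by (intro congruent[OF assms(2)[OF c(1)]]) (simp add: c Q_poly_pCons Q_minus Q_1)
    qed
  next
    case (times q1 q2)
    obtain p1 p2 where p12: "q1 = Q_poly p1" "q2 = Q_poly p2" using surj_Q_poly by (metis surjD)
    from times(1)[rule_format, OF p12(1)[symmetric]] times(2)[rule_format, OF p12(2)[symmetric]]
    obtain x1 x2 where lim: "((\<lambda>i. l i p1) \<longlongrightarrow> x1) G" "((\<lambda>i. l i p2) \<longlongrightarrow> x2) G"
      by (elim exE)
    have *: "((\<lambda>i. l i (p1 * p2)) \<longlongrightarrow> x1 * x2) G"
      by (rule Lim_transform_eventually[OF tendsto_mult[OF lim]])
        (use eventually_seminorm in eventually_elim, simp add: ultrametric_seminorm.mult)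
    show ?case
    proof (intro allI impI exI)
      fix p assume "Q_poly p = q1 * q2"
      then show "((\<lambda>i. l i p) \<longlongrightarrow> x1 * x2) G"
        by (intro congruent[OF *]) (simp add: p12 Q_poly_mult)
    qed
  qed
  then have "\<exists>x. ((\<lambda>i. l i p) \<longlongrightarrow> x) G" for p by simp
  then have L: "((\<lambda>i. l i p) \<longlongrightarrow> (SOME x. ((\<lambda>i. l i p) \<longlongrightarrow> x) G)) G" for p by (rule someI_ex)
  define L where "L p = (SOME x. ((\<lambda>i. l i p) \<longlongrightarrow> x) G)" for p
  note L = L[folded L_def]
  have "ultrametric_seminorm L" by (rule ultrametric_seminorm_tendsto[OF G eventually_seminorm L])
  moreover have "L [:a:] \<le> nu (to_fract a)" for a
    by (rule tendsto_upperbound[OF L _ G])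
      (use eventually_l in eventually_elim, simp add: affine_line_ring_iff)
  moreover have "L [:a:] = 0" if "\<not> a dvd 1" for a
    using tendsto_unique[OF G L nonunit[OF that]] .
  ultimately have "L \<in> Q_affine Q ` affine_line trivial_norm"
    by (simp add: Q_affine_image affine_line_ring_iff)
  then obtain \<mu> where "\<mu> \<in> affine_line trivial_norm" "L = \<mu> \<circ> Q_poly" by (auto simp: Q_affine_def)
  then show ?thesis using L by (intro bexI[of _ \<mu>]) simp_all
qed

lemma tendsto_zero_nonunit:
  assumes \<omega>: "filterlim \<omega> at_top G" and "\<not> a dvd 1"
  shows "((\<lambda>i. l i [:a:]) \<longlongrightarrow> 0) G"
proof -
  have "((\<lambda>i. nu (to_fract a) powr \<omega> i) \<longlongrightarrow> 0) G"
  proof (cases "a = 0")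
    case False
    then have neg: "ln (nu (to_fract a)) < 0" using assms(2) by (simp add: not_dvd_one_iff nu_pos)
    have "filterlim (\<lambda>i. ln (nu (to_fract a)) * \<omega> i) at_bot G"
      using filterlim_tendsto_neg_mult_at_bot[OF tendsto_const neg \<omega>] .
    then have "((\<lambda>i. exp (ln (nu (to_fract a)) * \<omega> i)) \<longlongrightarrow> 0) G"
      by (rule filterlim_compose[OF exp_at_bot])
    then show ?thesis using False by (simp add: powr_def mult.commute)
  qed (simp add: nu.zero)
  then show ?thesis
    by (rule Lim_transform_eventually) (use eventually_const in eventually_elim, simp)
qed

text \<open>
  In the class of \<open>b\<close>, the polynomials \<open>t - c\<close> and \<open>t - b\<close> differ by a non-unit, whose norm tends to 0.
  In any other class they differ by a unit, of norm 1, which eventually dominates \<open>t - b\<close>.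
\<close>

lemma converges_to_zeta_radius_less_one:
  assumes \<omega>: "filterlim \<omega> at_top G" and lim: "((\<lambda>i. l i [:- b, 1:]) \<longlongrightarrow> \<tau>) G" and \<tau>: "\<tau> < 1"
  shows "zeta trivial_norm (Q b) \<tau> \<in> affine_line trivial_norm"
    and "\<And>p. ((\<lambda>i. l i p) \<longlongrightarrow> zeta trivial_norm (Q b) \<tau> (Q_poly p)) G"
proof -
  have linear: "((\<lambda>i. l i [:- c, 1:]) \<longlongrightarrow> (if Q c = Q b then \<tau> else 1)) G" for c
  proof (cases "Q c = Q b")
    case True
    have "((\<lambda>i. l i ([:- b, 1:] - [:- c, 1:])) \<longlongrightarrow> 0) G"
      using tendsto_zero_nonunit[OF \<omega>, of "c - b"] True by (simp add: Q_diff flip: Q_eq_0_iff)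
    then show ?thesis using tendsto_of_diff[OF lim] True by simp
  next
    case False
    then have unit: "(b - c) dvd 1" using Q_eq_0_iff[of "b - c"] by (simp add: Q_diff)
    have "\<forall>\<^sub>F i in G. l i [:- c, 1:] = 1"
      using order_tendstoD(2)[OF lim \<tau>] eventually_l
    proof eventually_elim
      case (elim i)
      interpret ultrametric_seminorm "l i" using elim by (simp add: affine_line_ring_iff)
      have "l i [:b - c:] = 1" using elim affine_line_ring_unit[OF _ unit] by blast
      then have "l i ([:b - c:] + [:- b, 1:]) = 1" using elim by (subst dominant) auto
      then show ?case by simp
    qed
    then show ?thesis using False by (simp add: tendsto_eventually)
  qed
  from converges_if_linear_converge[OF tendsto_zero_nonunit[OF \<omega>] linear]
  obtain \<mu> where \<mu>: "\<mu> \<in> affine_line trivial_norm" "\<forall>p. ((\<lambda>i. l i p) \<longlongrightarrow> \<mu> (Q_poly p)) G" ..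
  have "\<mu> [:- Q b, 1:] = \<tau>"
    using tendsto_unique[OF G \<mu>(2)[rule_format] lim] by (simp add: Q_poly_pCons Q_minus Q_1)
  then have "\<mu> = zeta trivial_norm (Q b) \<tau>"
    using affine_line_trivial_eq_zeta_radius_less_one residue_field_algebraically_closed \<mu>(1) \<tau> by blast
  then show "zeta trivial_norm (Q b) \<tau> \<in> affine_line trivial_norm"
    and "\<And>p. ((\<lambda>i. l i p) \<longlongrightarrow> zeta trivial_norm (Q b) \<tau> (Q_poly p)) G"
    using \<mu> by auto
qed

lemma converges_to_zeta_radius_ge_one:
  assumes \<omega>: "filterlim \<omega> at_top G" and lim: "\<And>c. c \<in> C \<Longrightarrow> ((\<lambda>i. l i [:- c, 1:]) \<longlongrightarrow> \<tau>) G"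
    and \<tau>: "1 \<le> \<tau>"
  shows "zeta trivial_norm (0 :: 'f) \<tau> \<in> affine_line trivial_norm"
    and "\<And>p. ((\<lambda>i. l i p) \<longlongrightarrow> zeta trivial_norm 0 \<tau> (Q_poly p)) G"
proof -
  from converges_if_linear_converge[OF tendsto_zero_nonunit[OF \<omega>] lim]
  obtain \<mu> where \<mu>: "\<mu> \<in> affine_line trivial_norm" "\<forall>p. ((\<lambda>i. l i p) \<longlongrightarrow> \<mu> (Q_poly p)) G" ..
  have "\<mu> [:- s, 1:] = \<tau>" for s
  proof -
    obtain c where "c \<in> C" "s = Q c" by (rule representative)
    then show ?thesis
      using tendsto_unique[OF G \<mu>(2)[rule_format] lim] by (simp add: Q_poly_pCons Q_minus Q_1)
  qed
  then have "\<mu> = zeta trivial_norm 0 \<tau>"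
    using affine_line_trivial_eq_zeta_radius_ge_one residue_field_algebraically_closed \<mu>(1) \<tau> by blast
  then show "zeta trivial_norm (0 :: 'f) \<tau> \<in> affine_line trivial_norm"
    and "\<And>p. ((\<lambda>i. l i p) \<longlongrightarrow> zeta trivial_norm 0 \<tau> (Q_poly p)) G"
    using \<mu> by auto
qed

text \<open>
  Constants have norm at most 1, so eventually \<open>t\<close> dominates them in every \<open>t - c\<close>.
\<close>

lemma converges_to_zeta_radius_greater_one:
  assumes \<omega>: "filterlim \<omega> at_top G" and lim: "((\<lambda>i. l i [:0, 1:]) \<longlongrightarrow> \<tau>) G" and \<tau>: "1 < \<tau>"
  shows "zeta trivial_norm (0 :: 'f) \<tau> \<in> affine_line trivial_norm"
    and "\<And>p. ((\<lambda>i. l i p) \<longlongrightarrow> zeta trivial_norm 0 \<tau> (Q_poly p)) G"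
proof -
  have linear: "((\<lambda>i. l i [:- c, 1:]) \<longlongrightarrow> \<tau>) G" for c
  proof (rule Lim_transform_eventually[OF lim])
    show "\<forall>\<^sub>F i in G. l i [:0, 1:] = l i [:- c, 1:]"
      using order_tendstoD(1)[OF lim \<tau>] eventually_l
    proof eventually_elim
      case (elim i)
      interpret ultrametric_seminorm "l i" using elim by (simp add: affine_line_ring_iff)
      have "l i [:c:] \<le> 1"
        using elim nu_to_fract_le_one[of c] by (auto simp: affine_line_ring_iff intro: order_trans)
      then have "l i ([:0, 1:] - [:c:]) = l i [:0, 1:]" using elim by (intro dominant_diff) simp
      then show ?case by simp
    qed
  qed
  show "zeta trivial_norm (0 :: 'f) \<tau> \<in> affine_line trivial_norm"
    and "\<And>p. ((\<lambda>i. l i p) \<longlongrightarrow> zeta trivial_norm 0 \<tau> (Q_poly p)) G"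
    using converges_to_zeta_radius_ge_one[OF \<omega> linear] \<tau> by simp_all
qed

text \<open>
  Since \<open>nu \<pi> < 1\<close>, the function \<open>nu \<pi> powr \<omega>\<close> of \<open>\<omega>\<close> is small only for large \<open>\<omega>\<close>.
\<close>

lemma exponents_at_top:
  assumes "((\<lambda>i. l i [:\<pi>:]) \<longlongrightarrow> 0) G"
  shows "filterlim \<omega> at_top G"
  unfolding filterlim_at_top_dense
proof
  fix Z
  have "0 < nu (to_fract \<pi>) powr Z" using \<pi>_nonzero by simp
  from order_tendstoD(2)[OF assms this] eventually_const
  show "\<forall>\<^sub>F i in G. Z < \<omega> i"
  proof eventually_elim
    case (elim i)
    show ?case
    proof (rule ccontr)
      assume "\<not> Z < \<omega> i"
      then have "nu (to_fract \<pi>) powr Z \<le> nu (to_fract \<pi>) powr \<omega> i"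
        using nu_\<pi>_pos nu_\<pi>_less_one by (intro powr_mono') auto
      also have "\<dots> = l i [:\<pi>:]" using elim(2) by metis
      finally show False using elim(1) by linarith
    qed
  qed
qed

end

lemma limitin_affine_line:
  "limitin (affine_line_topology N) f l G \<longleftrightarrow>
    l \<in> affine_line N \<and> (\<forall>\<^sub>F i in G. f i \<in> affine_line N) \<and> (\<forall>p. ((\<lambda>i. f i p) \<longlongrightarrow> l p) G)"
  by (simp add: affine_line_topology_def limitin_subtopology limitin_componentwise)

lemma in_closure_if_pointwise_limit:
  assumes S: "S \<subseteq> affine_line N" and l: "l \<in> affine_line N" and G: "G \<noteq> bot"
    and ev: "\<forall>\<^sub>F i in G. f i \<in> S" and lim: "\<And>p. ((\<lambda>i. f i p) \<longlongrightarrow> l p) G"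
  shows "l \<in> affine_line_topology N closure_of S"
proof -
  have "\<forall>\<^sub>F i in G. f i \<in> affine_line N" using ev by eventually_elim (use S in blast)
  then have "limitin (affine_line_topology N) f l G" using l lim by (simp add: limitin_affine_line)
  then have "(f \<longlongrightarrow> l) G" by (simp add: affine_line_topology_eq limitin_subtopology)
  moreover have "\<forall>\<^sub>F i in G. f i \<in> closure S"
    using ev by eventually_elim (use closure_subset in blast)
  ultimately have "l \<in> closure S" using Lim_in_closed_set closed_closure G by blast
  then show ?thesis using S l
    by (simp add: affine_line_topology_eq closure_of_subtopology inf_absorb2 euclidean_closure_of)
qed

context seminorm_net
begin

lemma l_linear: "l i [:- b, 1:] = lam i [:- to_fract b, 1:] powr \<omega> i"
  and l_variable: "l i [:0, 1:] = lam i [:0, 1:] powr \<omega> i"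
  by (simp_all add: l_eq map_poly_pCons)

lemma limitin_Q_affine_iff:
  assumes \<mu>: "\<mu> \<in> affine_line trivial_norm"
  shows "limitin (affine_line_topology (ring_norm nu)) (\<lambda>i. l i) (Q_affine Q \<mu>) G \<longleftrightarrow>
    (\<forall>p. ((\<lambda>i. l i p) \<longlongrightarrow> \<mu> (Q_poly p)) G)"
proof -
  have "Q_affine Q \<mu> \<in> affine_line (ring_norm nu)"
    using Q_affine_image \<mu> by blast
  then show ?thesis using eventually_l by (simp add: limitin_affine_line) (simp add: Q_affine_def)
qed

text \<open>
  If the net converges to \<open>\<mu>\<close>, then the three alternatives correspond to the position of \<open>\<mu>\<close> on the
  line over the trivially valued residue field: on one of the branches of radius less than 1, on
  the branch of radius greater than 1, or at the branching point.
\<close>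

lemma alternatives_if_convergent:
  assumes \<mu>: "\<mu> \<in> affine_line trivial_norm" and lim: "\<And>p. ((\<lambda>i. l i p) \<longlongrightarrow> \<mu> (Q_poly p)) G"
  shows "filterlim \<omega> at_top G"
    and "(\<exists>\<tau> b. 0 \<le> \<tau> \<and> \<tau> < 1 \<and> ((\<lambda>i. l i [:- b, 1:]) \<longlongrightarrow> \<tau>) G) \<or>
      (\<exists>\<tau>. 1 < \<tau> \<and> ((\<lambda>i. l i [:0, 1:]) \<longlongrightarrow> \<tau>) G) \<or>
      (\<forall>c\<in>C. ((\<lambda>i. l i [:- c, 1:]) \<longlongrightarrow> 1) G)"
proof -
  interpret \<mu>: ultrametric_seminorm \<mu> using \<mu> by (simp add: affine_line_trivial)
  have "Q_poly [:\<pi>:] = 0" using \<pi>_not_unit by (simp add: Q_poly_pCons Q_eq_0_iff)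
  then show "filterlim \<omega> at_top G" using exponents_at_top lim[of "[:\<pi>:]"] by (simp add: \<mu>.zero)
  have linear: "((\<lambda>i. l i [:- c, 1:]) \<longlongrightarrow> \<mu> [:- Q c, 1:]) G" for c
    using lim[of "[:- c, 1:]"] by (simp add: Q_poly_pCons Q_minus Q_1)
  have variable: "((\<lambda>i. l i [:0, 1:]) \<longlongrightarrow> \<mu> [:0, 1:]) G"
    using lim[of "[:0, 1:]"] by (simp add: Q_poly_pCons Q_0 Q_1)
  consider (less) b where "\<mu> [:- Q b, 1:] < 1" | (greater) "1 < \<mu> [:0, 1:]"
    | (equal) "\<And>b. 1 \<le> \<mu> [:- Q b, 1:]" "\<mu> [:0, 1:] \<le> 1"
    by (metis linorder_not_less)
  then show "(\<exists>\<tau> b. 0 \<le> \<tau> \<and> \<tau> < 1 \<and> ((\<lambda>i. l i [:- b, 1:]) \<longlongrightarrow> \<tau>) G) \<or>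
      (\<exists>\<tau>. 1 < \<tau> \<and> ((\<lambda>i. l i [:0, 1:]) \<longlongrightarrow> \<tau>) G) \<or>
      (\<forall>c\<in>C. ((\<lambda>i. l i [:- c, 1:]) \<longlongrightarrow> 1) G)"
  proof cases
    case less
    then show ?thesis using linear[of b] \<mu>.nonneg by blast
  next
    case greater
    then show ?thesis using variable by blast
  next
    case equal
    have "\<mu> [:- Q c, 1:] = 1" for c
    proof -
      have "\<mu> ([:0, 1:] - [:Q c:]) \<le> max (\<mu> [:0, 1:]) (\<mu> [:Q c:])" by (rule \<mu>.ultra_diff)
      also have "\<dots> \<le> 1"
        using equal(2) affine_line_trivial_const[OF \<mu>] by (simp add: trivial_norm_def)
      finally show ?thesis using equal(1)[of c] by simp
    qed
    then show ?thesis using linear by simp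
  qed
qed

lemma convergent_if_alternatives:
  assumes \<omega>: "filterlim \<omega> at_top G"
    and "(\<exists>\<tau> b. 0 \<le> \<tau> \<and> \<tau> < 1 \<and> ((\<lambda>i. l i [:- b, 1:]) \<longlongrightarrow> \<tau>) G) \<or>
      (\<exists>\<tau>. 1 < \<tau> \<and> ((\<lambda>i. l i [:0, 1:]) \<longlongrightarrow> \<tau>) G) \<or>
      (\<forall>c\<in>C. ((\<lambda>i. l i [:- c, 1:]) \<longlongrightarrow> 1) G)"
  shows "\<exists>\<mu>\<in>affine_line trivial_norm. \<forall>p. ((\<lambda>i. l i p) \<longlongrightarrow> \<mu> (Q_poly p)) G"
  using assms(2)
proof (elim disjE exE conjE)
  fix \<tau> b assume *: "((\<lambda>i. l i [:- b, 1:]) \<longlongrightarrow> \<tau>) G" "\<tau> < 1"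
  show ?thesis
    by (intro bexI[of _ "zeta trivial_norm (Q b) \<tau>"] allI converges_to_zeta_radius_less_one[OF \<omega> *])
next
  fix \<tau> assume *: "((\<lambda>i. l i [:0, 1:]) \<longlongrightarrow> \<tau>) G" "1 < \<tau>"
  show ?thesis
    by (intro bexI[of _ "zeta trivial_norm 0 \<tau>"] allI converges_to_zeta_radius_greater_one[OF \<omega> *])
next
  assume *: "\<forall>c\<in>C. ((\<lambda>i. l i [:- c, 1:]) \<longlongrightarrow> 1) G"
  show ?thesis
    by (intro bexI[of _ "zeta trivial_norm 0 1"] allI converges_to_zeta_radius_ge_one[OF \<omega> *[rule_format]])
      simp_all
qed

lemma limit_eq_zeta:
  assumes \<mu>: "\<mu> \<in> affine_line trivial_norm" and lim: "\<And>p. ((\<lambda>i. l i p) \<longlongrightarrow> \<mu> (Q_poly p)) G"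
  shows "\<tau> < 1 \<Longrightarrow> ((\<lambda>i. l i [:- b, 1:]) \<longlongrightarrow> \<tau>) G \<Longrightarrow> \<mu> = zeta trivial_norm (Q b) \<tau>"
    and "1 < \<tau> \<Longrightarrow> ((\<lambda>i. l i [:0, 1:]) \<longlongrightarrow> \<tau>) G \<Longrightarrow> \<mu> = zeta trivial_norm 0 \<tau>"
    and "(\<And>c. c \<in> C \<Longrightarrow> ((\<lambda>i. l i [:- c, 1:]) \<longlongrightarrow> 1) G) \<Longrightarrow> \<mu> = zeta trivial_norm 0 1"
proof -
  note \<omega> = alternatives_if_convergent(1)[OF assms]
  have unique: "\<mu> = \<mu>'" if lim': "\<And>p. ((\<lambda>i. l i p) \<longlongrightarrow> \<mu>' (Q_poly p)) G" for \<mu>'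
  proof
    fix q
    obtain p where p: "q = Q_poly p" using surj_Q_poly by (metis surjD)
    show "\<mu> q = \<mu>' q" unfolding p by (rule tendsto_unique[OF G lim lim'])
  qed
  show "\<mu> = zeta trivial_norm (Q b) \<tau>" if "\<tau> < 1" "((\<lambda>i. l i [:- b, 1:]) \<longlongrightarrow> \<tau>) G"
    by (rule unique) (rule converges_to_zeta_radius_less_one(2)[OF \<omega> that(2,1)])
  show "\<mu> = zeta trivial_norm 0 \<tau>" if "1 < \<tau>" "((\<lambda>i. l i [:0, 1:]) \<longlongrightarrow> \<tau>) G"
    by (rule unique) (rule converges_to_zeta_radius_greater_one(2)[OF \<omega> that(2,1)])
  show "\<mu> = zeta trivial_norm 0 1" if "\<And>c. c \<in> C \<Longrightarrow> ((\<lambda>i. l i [:- c, 1:]) \<longlongrightarrow> 1) G"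
    by (rule unique) (rule converges_to_zeta_radius_ge_one(2)[OF \<omega> that order_refl])
qed

end

section \<open>Density of the classical points\<close>

lemma zeta_radius_zero:
  assumes "N 0 = 0" "\<And>a. 0 \<le> N a"
  shows "zeta N r 0 p = N (poly p r)"
  unfolding zeta_def
proof (rule Max_eqI)
  have "coeff (p \<circ>\<^sub>p [:r, 1:]) 0 = poly p r" by (simp add: poly_pcompose flip: poly_0_coeff_0)
  then show "N (poly p r) \<in> (\<lambda>k. N (coeff (p \<circ>\<^sub>p [:r, 1:]) k) * 0 ^ k) ` {..degree p}"
    by (intro image_eqI[of _ _ 0]) auto
  fix y assume "y \<in> (\<lambda>k. N (coeff (p \<circ>\<^sub>p [:r, 1:]) k) * 0 ^ k) ` {..degree p}"
  then obtain k where "y = N (coeff (p \<circ>\<^sub>p [:r, 1:]) k) * 0 ^ k" by blast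
  then show "y \<le> N (poly p r)"
    using \<open>coeff (p \<circ>\<^sub>p [:r, 1:]) 0 = poly p r\<close> assms by (cases k) auto
qed simp

context alg_closed_valuation
begin

lemma zeta_classical: "zeta nu r 0 p = nu (poly p r)"
  by (rule zeta_radius_zero) (simp_all add: nu.zero nu.nonneg)

lemma zeta_classical_in_affine_line: "zeta nu r 0 \<in> affine_line nu"
proof -
  have "ultrametric_seminorm (nu \<circ> (\<lambda>p. poly p r))" by (rule nu.comp_seminorm) simp_all
  moreover have "zeta nu r 0 = nu \<circ> (\<lambda>p. poly p r)" by (auto simp: zeta_classical)
  ultimately show ?thesis by (simp add: nu.affine_line_iff)
qed

definition classical_points :: "('r poly \<Rightarrow> real) set" where
  "classical_points = (\<lambda>(r, \<omega>). J_affine (norm_power (zeta nu r 0) \<omega>)) ` (UNIV \<times> {1<..})"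

lemma Lambda_classical: "1 < \<omega> \<Longrightarrow> Lambda (zeta nu r 0, \<omega>) \<in> classical_points"
  by (force simp: classical_points_def Lambda_def)

lemma classical_points_subset: "classical_points \<subseteq> generic_part"
  using Lambda_in_generic_part[OF zeta_classical_in_affine_line]
  by (auto simp: classical_points_def Lambda_def)

text \<open>
  Let \<open>a0 \<in> A\<close> minimise \<open>\<rho> = m (t - a0)\<close>. By the ultrametric inequality
  \<open>m (t - a) = max \<rho> (nu (a0 - a))\<close> for all \<open>a \<in> A\<close>. The point \<open>r = a0 + e\<close> satisfies the same
  equation with \<open>nu e\<close> in place of \<open>\<rho>\<close>, provided that \<open>nu e\<close> avoids the finitely many values
  \<open>nu (a0 - a)\<close>; and \<open>nu e\<close> may be chosen slightly larger than \<open>\<rho>\<close>.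
\<close>

lemma classical_approximation:
  assumes m: "m \<in> affine_line nu" and A: "finite A" and \<delta>: "0 < \<delta>"
  shows "\<exists>r. \<forall>a\<in>A. \<bar>nu (r - a) - m [:- a, 1:]\<bar> \<le> \<delta>"
proof (cases "A = {}")
  case False
  interpret m: ultrametric_seminorm m using m by (simp add: nu.affine_line_iff)
  have const: "m [:x:] = nu x" for x
    by (rule affine_line_const[OF nu.ultrametric_seminorm_axioms m])
  obtain a0 where a0: "a0 \<in> A" "\<And>a. a \<in> A \<Longrightarrow> m [:- a0, 1:] \<le> m [:- a, 1:]"
    using arg_min_if_finite[OF A False, of "\<lambda>a. m [:- a, 1:]"] by (metis linorder_not_less)
  define \<rho> where "\<rho> = m [:- a0, 1:]"
  \<comment> \<open>Below \<open>Min D\<close>, \<open>nu e\<close> stays under each \<open>nu (a0 - a)\<close> that exceeds \<open>\<rho>\<close> and within \<open>\<delta>\<close> of \<open>\<rho>\<close>.\<close>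
  define D where "D = insert (\<rho> + \<delta>) {nu (a0 - a) | a. a \<in> A \<and> \<rho> < nu (a0 - a)}"
  have D: "finite D" "D \<noteq> {}" using A by (auto simp: D_def)
  have "\<rho> < Min D" using D \<delta> by (auto simp: D_def)
  then obtain e where e: "\<rho> < nu e" "nu e < Min D"
    using nu_dense[of \<rho> "Min D"] m.nonneg[of "[:- a0, 1:]"] unfolding \<rho>_def by blast
  have "\<bar>nu (a0 + e - a) - m [:- a, 1:]\<bar> \<le> \<delta>" if a: "a \<in> A" for a
  proof -
    have split: "[:- a, 1:] = [:a0 - a:] + [:- a0, 1:]" by simp
    show ?thesis
    proof (cases "\<rho> < nu (a0 - a)")
      case True
      then have "nu (a0 - a) \<in> D" using a by (auto simp: D_def)
      then have "nu e < nu (a0 - a)" using e(2) D by (auto intro: less_le_trans)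
      then have "nu (a0 - a + e) = nu (a0 - a)" by (rule nu.dominant)
      moreover have "m [:- a, 1:] = nu (a0 - a)"
        unfolding split using True by (subst m.dominant) (auto simp: const \<rho>_def)
      ultimately show ?thesis using \<delta> by (simp add: algebra_simps)
    next
      case False
      then have "nu (e + (a0 - a)) = nu e" using e by (intro nu.dominant) simp
      moreover have "m [:- a, 1:] = \<rho>"
        using m.ultra[of "[:a0 - a:]" "[:- a0, 1:]"] False a0(2)[OF a]
        unfolding split[symmetric] const \<rho>_def by simp
      moreover have "nu e < \<rho> + \<delta>" using e(2) D by (simp add: D_def)
      ultimately show ?thesis using e(1) by (simp add: algebra_simps)
    qed
  qed
  then show ?thesis by blast
qed simp

text \<open>
  The approximating net is indexed by a finite set of centres \<open>a\<close> together with an error bound; the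
  error bound is also added to the exponent, which keeps the exponent above 1 when \<open>\<omega> = 1\<close>.
\<close>

lemma generic_part_in_closure:
  assumes "l \<in> generic_part"
  shows "l \<in> affine_line_topology (ring_norm nu) closure_of classical_points"
proof -
  have "l \<in> Lambda ` (affine_line nu \<times> {1..})" using assms by (simp only: Lambda_image)
  then obtain m \<omega> where m: "m \<in> affine_line nu" "1 \<le> \<omega>" and l: "l = Lambda (m, \<omega>)" by auto
  interpret m: ultrametric_seminorm m using m by (simp add: nu.affine_line_iff)
  define H :: "('r fract set \<times> real) filter" where "H = finite_subsets_at_top UNIV \<times>\<^sub>F at_right 0"
  have H: "H \<noteq> bot" by (simp add: H_def prod_filter_eq_bot)
  have snd: "filterlim snd (at_right 0) H" unfolding H_def by (rule filterlim_snd)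
  have snd0: "(snd \<longlongrightarrow> 0) H" using snd by (simp add: filterlim_at)
  have pos: "\<forall>\<^sub>F x in H. 0 < snd x" using snd by (simp add: filterlim_at eventually_conj_iff)
  define r where "r x = (SOME r. \<forall>a\<in>fst x. \<bar>nu (r - a) - m [:- a, 1:]\<bar> \<le> snd x)" for x
  have r: "\<forall>a\<in>fst x. \<bar>nu (r x - a) - m [:- a, 1:]\<bar> \<le> snd x" if "finite (fst x)" "0 < snd x" for x
    unfolding r_def using classical_approximation[OF m(1) that] by (rule someI_ex)
  have lim: "((\<lambda>x. nu (poly p (r x))) \<longlongrightarrow> m p) H" for p
    using alg_closed
  proof (induction p rule: algebraically_closed_induct)
    case (const a)
    show ?case using affine_line_const[OF nu.ultrametric_seminorm_axioms m(1)] by simp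
  next
    case (linear a)
    have "\<forall>\<^sub>F X in finite_subsets_at_top UNIV. finite X \<and> a \<in> X"
      unfolding eventually_finite_subsets_at_top by (rule exI[of _ "{a}"]) auto
    then have "\<forall>\<^sub>F x in H. finite (fst x) \<and> a \<in> fst x"
      unfolding H_def by (rule eventually_compose_filterlim[OF _ filterlim_fst])
    then have ev: "\<forall>\<^sub>F x in H. norm (nu (r x - a) - m [:- a, 1:]) \<le> snd x"
      using pos
    proof eventually_elim
      case (elim x)
      then have "\<bar>nu (r x - a) - m [:- a, 1:]\<bar> \<le> snd x" using r[of x] by blast
      then show ?case by simp
    qed
    have "((\<lambda>x. nu (r x - a) - m [:- a, 1:]) \<longlongrightarrow> 0) H"
      by (rule Lim_null_comparison[OF ev snd0])
    then show ?case by (simp add: LIM_zero_iff)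
  next
    case (times p q)
    then show ?case by (simp add: nu.mult m.mult tendsto_mult)
  qed
  show ?thesis
  proof (rule in_closure_if_pointwise_limit[OF _ _ H])
    show "classical_points \<subseteq> affine_line (ring_norm nu)" "l \<in> affine_line (ring_norm nu)"
      using classical_points_subset generic_part_subset assms by auto
    show "\<forall>\<^sub>F x in H. Lambda (zeta nu (r x) 0, \<omega> + snd x) \<in> classical_points"
      using pos by eventually_elim (use m(2) in \<open>simp add: Lambda_classical\<close>)
    fix p
    have "((\<lambda>x. nu (poly (map_poly to_fract p) (r x)) powr (\<omega> + snd x))
        \<longlongrightarrow> m (map_poly to_fract p) powr (\<omega> + 0)) H"
      by (intro tendsto_powr' lim tendsto_add tendsto_const snd0)
        (use m(2) in \<open>auto simp: nu.nonneg\<close>)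
    then show "((\<lambda>x. Lambda (zeta nu (r x) 0, \<omega> + snd x) p) \<longlongrightarrow> l p) H"
      by (simp add: l Lambda_def J_affine_def norm_power_def zeta_classical)
  qed
qed

text \<open>
  A point \<open>\<mu>\<close> over the residue field lies on the branch through some residue class \<open>Q b\<close>, at radius
  \<open>\<rho>\<close>. It is the limit of classical points \<open>b + e\<close> with exponents \<open>\<omega>\<close> tending to infinity and
  \<open>nu e powr \<omega>\<close> tending to \<open>\<rho>\<close> from above. At the branching point \<open>\<rho> = 1\<close> the approach from above
  makes \<open>nu e > 1\<close>, so that \<open>e\<close> stays at the same distance from all elements of the valuation ring.
\<close>

lemma residue_part_in_closure:
  assumes \<mu>: "\<mu> \<in> affine_line trivial_norm"
  shows "Q_affine Q \<mu> \<in> affine_line_topology (ring_norm nu) closure_of classical_points"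
proof -
  interpret \<mu>: ultrametric_seminorm \<mu> using \<mu> by (simp add: affine_line_trivial)
  obtain b where b: "\<mu> [:- Q b, 1:] < 1 \<or> (b = 0 \<and> (\<forall>c. 1 \<le> \<mu> [:- Q c, 1:]))"
    by (metis linorder_not_less)
  define \<rho> where "\<rho> = \<mu> [:- Q b, 1:]"
  define \<omega> where "\<omega> n = 2 + real n" for n :: nat
  have \<omega>_pos: "1 < \<omega> n" "0 < \<omega> n" for n by (simp_all add: \<omega>_def)
  \<comment> \<open>The window of width \<open>1 / \<omega> n\<close> shrinks, which gives the limit \<open>\<rho>\<close>.\<close>
  define e where "e n = (SOME e. \<rho> < nu e powr \<omega> n \<and> nu e powr \<omega> n < \<rho> + 1 / \<omega> n)" for n
  have e: "\<rho> < nu (e n) powr \<omega> n \<and> nu (e n) powr \<omega> n < \<rho> + 1 / \<omega> n" for n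
    unfolding e_def
  proof (rule someI_ex)
    have \<rho>: "0 \<le> \<rho>" by (simp add: \<rho>_def \<mu>.nonneg)
    have "\<rho> powr (1 / \<omega> n) < (\<rho> + 1 / \<omega> n) powr (1 / \<omega> n)"
      using \<omega>_pos[of n] \<rho> by (intro powr_less_mono2) auto
    then obtain x where x: "\<rho> powr (1 / \<omega> n) < nu x" "nu x < (\<rho> + 1 / \<omega> n) powr (1 / \<omega> n)"
      by (rule nu_dense[OF powr_ge_zero])
    have "(\<rho> powr (1 / \<omega> n)) powr \<omega> n < nu x powr \<omega> n"
      "nu x powr \<omega> n < ((\<rho> + 1 / \<omega> n) powr (1 / \<omega> n)) powr \<omega> n"
      using x \<omega>_pos[of n] by (auto intro!: powr_less_mono2 simp: nu.nonneg)
    then show "\<exists>x. \<rho> < nu x powr \<omega> n \<and> nu x powr \<omega> n < \<rho> + 1 / \<omega> n"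
      using \<omega>_pos[of n] \<rho> by (auto simp: powr_powr)
  qed
  have \<omega>: "filterlim \<omega> at_top sequentially"
    unfolding \<omega>_def
    by (rule filterlim_tendsto_add_at_top[OF tendsto_const filterlim_real_sequentially])
  interpret net: seminorm_net nu Q sequentially "\<lambda>n. zeta nu (to_fract b + e n) 0" \<omega> UNIV
    by unfold_locales
      (simp_all add: zeta_classical_in_affine_line surj_Q \<omega>_pos[THEN less_imp_le])
  have linear: "net.l n [:- c, 1:] = nu (to_fract b + e n - to_fract c) powr \<omega> n" for n c
    by (simp add: net.l_linear zeta_classical)
  have lim_b: "(\<lambda>n. net.l n [:- b, 1:]) \<longlonglongrightarrow> \<rho>"
  proof (rule tendsto_sandwich[OF _ _ tendsto_const])
    have "(\<lambda>n. \<rho> + 1 / \<omega> n) \<longlonglongrightarrow> \<rho> + 0"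
      by (intro tendsto_add tendsto_const real_tendsto_divide_at_top[OF tendsto_const \<omega>])
    then show "(\<lambda>n. \<rho> + 1 / \<omega> n) \<longlonglongrightarrow> \<rho>" by simp
  qed (use e in \<open>auto simp: linear intro!: always_eventually less_imp_le\<close>)
  have "\<forall>p. (\<lambda>n. net.l n p) \<longlonglongrightarrow> \<mu> (Q_poly p)"
  proof (cases "\<rho> < 1")
    case True
    have "\<mu> = zeta trivial_norm (Q b) \<rho>"
      using affine_line_trivial_eq_zeta_radius_less_one[OF residue_field_algebraically_closed \<mu>]
        True \<rho>_def by blast
    then show ?thesis using net.converges_to_zeta_radius_less_one(2)[OF \<omega> lim_b True] by simp
  next
    case False
    then have b0: "b = 0" and ge: "\<And>c. 1 \<le> \<mu> [:- Q c, 1:]" and \<rho>: "1 \<le> \<rho>" using b \<rho>_def by auto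
    have \<mu>_linear: "\<mu> [:- s, 1:] = \<rho>" for s
    proof -
      obtain c where c: "s = Q c" using surj_Q by (metis surjD)
      have "\<mu> [:s:] \<le> 1" using affine_line_trivial_const[OF \<mu>] by (simp add: trivial_norm_def)
      then have "\<mu> ([:0, 1:] - [:s:]) \<le> \<rho>" "\<rho> \<le> max (\<mu> [:- s, 1:]) 1"
        using \<mu>.ultra_diff[of "[:0, 1:]" "[:s:]"] \<mu>.ultra[of "[:- s, 1:]" "[:s:]"] \<rho>
        by (auto simp: \<rho>_def b0 Q_0)
      then show ?thesis using ge[of c] c by auto
    qed
    then have \<mu>_eq: "\<mu> = zeta trivial_norm 0 \<rho>"
      using affine_line_trivial_eq_zeta_radius_ge_one[OF residue_field_algebraically_closed \<mu>] \<rho> by blast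
    have "net.l n [:- c, 1:] = net.l n [:- b, 1:]" for n c
    proof -
      have "1 < nu (e n)"
      proof (rule ccontr)
        assume "\<not> 1 < nu (e n)"
        then have "nu (e n) powr \<omega> n \<le> 1" using \<omega>_pos[of n] by (intro powr_le1) (auto simp: nu.nonneg)
        then show False using e[of n] \<rho> by simp
      qed
      then have "nu (e n - to_fract c) = nu (e n)"
        using nu_to_fract_le_one[of c] by (intro nu.dominant_diff) simp
      then show ?thesis using linear[of n c] linear[of n b] by (simp add: b0)
    qed
    then have eq: "(\<lambda>n. net.l n [:- c, 1:]) = (\<lambda>n. net.l n [:- b, 1:])" for c by blast
    have "(\<lambda>n. net.l n [:- c, 1:]) \<longlonglongrightarrow> \<rho>" for c by (subst eq) (rule lim_b)
    then show ?thesis using net.converges_to_zeta_radius_ge_one(2)[OF \<omega> _ \<rho>] by (simp add: \<mu>_eq)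
  qed
  then have lim: "(\<lambda>n. net.l n p) \<longlonglongrightarrow> Q_affine Q \<mu> p" for p by (simp add: Q_affine_def)
  show ?thesis
  proof (rule in_closure_if_pointwise_limit[OF _ _ _ _ lim])
    show "classical_points \<subseteq> affine_line (ring_norm nu)"
      using classical_points_subset generic_part_subset by blast
    show "Q_affine Q \<mu> \<in> affine_line (ring_norm nu)" using Q_affine_image \<mu> by blast
  qed (use Lambda_classical \<omega>_pos in auto)
qed

lemma dense_classical_points: "dense_subset (affine_line_topology (ring_norm nu)) classical_points"
proof -
  have "l \<in> affine_line_topology (ring_norm nu) closure_of classical_points"
    if l: "l \<in> affine_line (ring_norm nu)" for l
  proof (cases "l \<in> generic_part")
    case False
    then have "l \<in> Q_affine Q ` affine_line trivial_norm" using l by (simp add: Q_affine_image_eq)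
    then show ?thesis using residue_part_in_closure by auto
  qed (rule generic_part_in_closure)
  moreover have "topspace (affine_line_topology (ring_norm nu)) = affine_line (ring_norm nu)"
    by (simp add: affine_line_topology_eq)
  ultimately show ?thesis
    using classical_points_subset generic_part_subset
      closure_of_subset_topspace[of "affine_line_topology (ring_norm nu)" classical_points]
    by (auto simp: dense_subset_def)
qed

lemma dense_generic_part: "dense_subset (affine_line_topology (ring_norm nu)) generic_part"
  using dense_classical_points generic_part_subset closure_of_mono[OF classical_points_subset]
    closure_of_subset_topspace[of "affine_line_topology (ring_norm nu)" generic_part]
  by (fastforce simp: dense_subset_def affine_line_topology_eq)

end

section \<open>The topology of the affine line over a complete valuation ring\<close>

theorem theorem2p6:
  fixes nu :: "'r::idom fract \<Rightarrow> real"
    and Q :: "'r \<Rightarrow> 'f::field"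
    and Ft :: "'r set"
  assumes cvr: "complete_valuation_ring nu"
    and not_field: "\<not> (\<forall>a::'r. a \<noteq> 0 \<longrightarrow> a dvd 1)"
    and residue: "residue_map Q"
    and alg_closed: "algebraically_closed_field TYPE('r fract)"
    and cross: "cross_section Q Ft"
    and cross_zero: "0 \<in> Ft"
  shows
    \<comment> \<open>(a)\<close>
    "closedin (affine_line_topology (ring_norm nu)) (Q_affine Q ` affine_line trivial_norm)
     \<and>
     \<comment> \<open>(b)\<close>
     homeomorphic_map
       (prod_topology (affine_line_topology nu) (top_of_set {1..}))
       (subtopology (affine_line_topology (ring_norm nu))
          (\<Union>\<omega>\<in>{1..}. J_affine ` affine_line (norm_power nu \<omega>)))
       Lambda
     \<and>
     \<comment> \<open>(c)\<close>
     (\<forall>(I :: 'i set) le lam \<omega>.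
       directed_index I le \<longrightarrow> (\<forall>i\<in>I. lam i \<in> affine_line nu \<and> 1 \<le> \<omega> i) \<longrightarrow>
       (let G = net_filter I le;
            converges_to = (\<lambda>l0. limitin (affine_line_topology (ring_norm nu))
                              (\<lambda>i. J_affine (norm_power (lam i) (\<omega> i))) (Q_affine Q l0) G);
            C1 = (\<lambda>\<tau> b. 0 \<le> \<tau> \<and> \<tau> < 1 \<and>
                     ((\<lambda>i. lam i [:- to_fract b, 1:] powr \<omega> i) \<longlongrightarrow> \<tau>) G);
            C2 = (\<lambda>\<tau>. 1 < \<tau> \<and> ((\<lambda>i. lam i [:0, 1:] powr \<omega> i) \<longlongrightarrow> \<tau>) G);
            C3 = (\<forall>c\<in>Ft. ((\<lambda>i. lam i [:- to_fract c, 1:] powr \<omega> i) \<longlongrightarrow> 1) G)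
        in ((\<exists>l0\<in>affine_line trivial_norm. converges_to l0) \<longleftrightarrow>
              filterlim \<omega> at_top G \<and> ((\<exists>\<tau>\<^sub>1 b. C1 \<tau>\<^sub>1 b) \<or> (\<exists>\<tau>\<^sub>2. C2 \<tau>\<^sub>2) \<or> C3)) \<and>
           (\<forall>l0\<in>affine_line trivial_norm. converges_to l0 \<longrightarrow>
              (\<forall>\<tau>\<^sub>1 b. C1 \<tau>\<^sub>1 b \<longrightarrow> l0 = zeta trivial_norm (Q b) \<tau>\<^sub>1) \<and>
              (\<forall>\<tau>\<^sub>2. C2 \<tau>\<^sub>2 \<longrightarrow> l0 = zeta trivial_norm 0 \<tau>\<^sub>2) \<and>
              (C3 \<longrightarrow> l0 = zeta trivial_norm 0 1))))
     \<and>
     \<comment> \<open>(d)\<close>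
     openin (affine_line_topology (ring_norm nu)) (Lambda ` (affine_line nu \<times> {1..})) \<and>
     dense_subset (affine_line_topology (ring_norm nu)) (Lambda ` (affine_line nu \<times> {1..})) \<and>
     dense_subset (affine_line_topology (ring_norm nu))
       ((\<lambda>(r, \<omega>). J_affine (norm_power (zeta nu r 0) \<omega>)) ` (UNIV \<times> {1<..}))"
proof -
  interpret alg_closed_valuation nu Q
    by unfold_locales (use cvr not_field residue alg_closed in \<open>auto simp: complete_valuation_ring_def\<close>)
  have a: "closedin (affine_line_topology (ring_norm nu)) (Q_affine Q ` affine_line trivial_norm)"
    unfolding Q_affine_image_eq by (rule closedin_not_generic_part)
  have representatives: "Q ` Ft = UNIV" using cross unfolding cross_section_def by (auto simp: image_iff) metis
  show ?thesis
    unfolding J_affine_image Lambda_image classical_points_def[symmetric]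
  proof (intro conjI a homeomorphic_map_Lambda openin_generic_part dense_generic_part
      dense_classical_points allI impI, unfold Let_def, goal_cases)
    case (1 I le lam \<omega>)
    define G where "G = net_filter I le"
    have eventually_I: "\<forall>\<^sub>F i in G. i \<in> I"
      using 1(1) unfolding G_def eventually_net_filter[OF 1(1)] directed_index_def by blast
    have "G \<noteq> bot"
      using 1(1) unfolding trivial_limit_def G_def eventually_net_filter[OF 1(1)] directed_index_def by blast
    moreover have "\<forall>\<^sub>F i in G. lam i \<in> affine_line nu \<and> 1 \<le> \<omega> i"
      using eventually_I by eventually_elim (use 1(2) in blast)
    ultimately interpret seminorm_net nu Q G lam \<omega> Ft
      using representatives by unfold_locales
    have l: "J_affine (norm_power (lam i) (\<omega> i)) = l i" for i by (simp add: Lambda_def)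
    show ?case
      unfolding l G_def[symmetric] l_linear[symmetric] l_variable[symmetric]
    proof (intro conjI iffI ballI allI impI, goal_cases)
      case 1
      then show ?case using alternatives_if_convergent(1) limitin_Q_affine_iff by blast
    next
      case 2
      then show ?case using alternatives_if_convergent(2) limitin_Q_affine_iff by blast
    next
      case 3
      then have "\<exists>\<mu>\<in>affine_line trivial_norm. \<forall>p. ((\<lambda>i. l i p) \<longlongrightarrow> \<mu> (Q_poly p)) G"
        by (intro convergent_if_alternatives) simp_all
      then show ?case using limitin_Q_affine_iff by auto
    next
      case (4 l0 \<tau> b)
      then show ?case using limit_eq_zeta(1)[of l0 \<tau> b] limitin_Q_affine_iff[of l0] by simp
    next
      case (5 l0 \<tau>)
      then show ?case using limit_eq_zeta(2)[of l0 \<tau>] limitin_Q_affine_iff[of l0] by simp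
    next
      case (6 l0)
      then show ?case using limit_eq_zeta(3)[of l0] limitin_Q_affine_iff[of l0] by simp
    qed
  qed
qed

end
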